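(* If $\mathbb{K}$ is a field of characteristic zero, then $T_2(E_{0^*}\otimes E_0)=I$, i.e. every $\mathbb{Z}_2$-graded identity of $E_{0^*}\otimes E_0$ follows from the identities (1)–(7). If $\mathbb{K}$ is an infinite field of characteristic $p>2$, then $T_2(E_{0^*}\otimes E_0)=I_p$, i.e. every $\mathbb{Z}_2$-graded identity follows from (1)–(7) together with (8) and (9).
   Context: $E$ is the Grassmann algebra of a vector space with countable basis $e_1,e_2,\dots$ (generated by the $e_i$ with $e_ie_j=-e_je_i$), with canonical $\mathbb{Z}_2$-grading $E=E^{(0)}\oplus E^{(1)}$ (even/odd length monomials). $A=E\otimes E$ has the $\mathbb{Z}_2\times\mathbb{Z}_2$-grading $A_{(a,b)}=E^{(a)}\otimes E^{(b)}$. $E_{0^*}\otimes E_0$ denotes $A$ with the $\mathbb{Z}_2$-grading $A_0=A_{(0,0)}\oplus A_{(1,0)}$, $A_1=A_{(0,1)}\oplus A_{(1,1)}$. $\mathbb{K}\langle Y\cup Z\rangle$ is the free associative algebra on disjoint countable sets $Y=\{y_1,\dots\}$ (degree $0$) and $Z=\{z_1,\dots\}$ (degree $1$). $T_2(A)$ is the set of polynomials vanishing under every substitution of the $y_i$ by elements of $A_0$ and the $z_i$ by elements of $A_1$. A $T_2$-ideal is an ideal stable under all graded endomorphisms (sending $y_i$ to degree-$0$ and $z_i$ to degree-$1$ polynomials). Notation: $[a,b]=ab-ba$, $[a_1,\dots,a_n]=[[a_1,\dots,a_{n-1}],a_n]$, $a\circ b=ab+ba$. The identities are: (1) $[y_1,y_2,y_3]$,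 $[y_1,y_2,z_3]$; (2) $[y_1,z_2,y_3]$; (3) $[y_1,z_2]\circ z_3$; (4) $[z_1\circ z_2,z_3]$; (5) $(z_1\circ z_2)(z_3\circ z_4)-(z_1\circ z_3)(z_2\circ z_4)$; (6) $[x_1,y_2][y_3,x_4]+[x_1,y_3][y_2,x_4]$ for all choices $x_1\in\{y_1,z_1\}$, $x_4\in\{y_4,z_4\}$; (7) $[y_1,z_2](z_3\circ z_4)-[y_1,z_3](z_2\circ z_4)$; and, in characteristic $p$, (8) $[y_1,z_1]\cdots[y_{2k-2},z_1](z_2\circ z_1)z_1^{2n}$ and (9) $[y_1,z_1]\cdots[y_{2k-1},z_1]z_1^{2n}$, for all integers $k\ge1$, $n\ge0$ with $2n+2k-1=p$. $I$ is the $T_2$-ideal generated by (1)–(7) and $I_p$ the $T_2$-ideal generated by (1)–(9). *)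

theory Defs
  imports Main
begin

text \<open>Variables: Y i has degree 0, Z i has degree 1.\<close>
datatype var = Y nat | Z nat

text \<open>A noncommutative polynomial is a finitely supported function from words
  (lists of variables) to the field; the word w stands for the monomial
  x_{w_1} x_{w_2} ... x_{w_n}.\<close>
type_synonym 'k fpoly = "var list \<Rightarrow> 'k"

definition FA :: "'k::field fpoly set" where
  "FA = {f. finite {w. f w \<noteq> 0}}"

definition pzero :: "'k::field fpoly" where "pzero = (\<lambda>w. 0)"
definition pone :: "'k::field fpoly" where "pone = (\<lambda>w. if w = [] then 1 else 0)"
definition padd :: "'k::field fpoly \<Rightarrow> 'k fpoly \<Rightarrow> 'k fpoly" where
  "padd f g = (\<lambda>w. f w + g w)"
definition psub :: "'k::field fpoly \<Rightarrow> 'k fpoly \<Rightarrow> 'k fpoly" where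
  "psub f g = (\<lambda>w. f w - g w)"
definition pmul :: "'k::field fpoly \<Rightarrow> 'k fpoly \<Rightarrow> 'k fpoly" where
  "pmul f g = (\<lambda>w. \<Sum>i\<le>length w. f (take i w) * g (drop i w))"
definition pvar :: "var \<Rightarrow> 'k::field fpoly" where
  "pvar x = (\<lambda>w. if w = [x] then 1 else 0)"

abbreviation y :: "nat \<Rightarrow> 'k::field fpoly" where "y i \<equiv> pvar (Y i)"
abbreviation z :: "nat \<Rightarrow> 'k::field fpoly" where "z i \<equiv> pvar (Z i)"

definition pcomm :: "'k::field fpoly \<Rightarrow> 'k fpoly \<Rightarrow> 'k fpoly" where
  "pcomm a b = psub (pmul a b) (pmul b a)"
definition pjor :: "'k::field fpoly \<Rightarrow> 'k fpoly \<Rightarrow> 'k fpoly" where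
  "pjor a b = padd (pmul a b) (pmul b a)"
definition pprod :: "'k::field fpoly list \<Rightarrow> 'k fpoly" where
  "pprod fs = foldr pmul fs pone"
definition ppow :: "'k::field fpoly \<Rightarrow> nat \<Rightarrow> 'k fpoly" where
  "ppow f n = pprod (replicate n f)"

definition wdeg_odd :: "var list \<Rightarrow> bool" where
  "wdeg_odd w = odd (length (filter (\<lambda>x. case x of Y _ \<Rightarrow> False | Z _ \<Rightarrow> True) w))"

definition FA0 :: "'k::field fpoly set" where
  "FA0 = {f \<in> FA. \<forall>w. f w \<noteq> 0 \<longrightarrow> \<not> wdeg_odd w}"
definition FA1 :: "'k::field fpoly set" where
  "FA1 = {f \<in> FA. \<forall>w. f w \<noteq> 0 \<longrightarrow> wdeg_odd w}"

definition psubst :: "(var \<Rightarrow> 'k::field fpoly) \<Rightarrow> 'k fpoly \<Rightarrow> 'k fpoly" where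
  "psubst \<psi> f = (\<lambda>u. \<Sum>w\<in>{w. f w \<noteq> 0}. f w * pprod (map \<psi> w) u)"

definition graded_endo :: "(var \<Rightarrow> 'k::field fpoly) \<Rightarrow> bool" where
  "graded_endo \<psi> \<longleftrightarrow> (\<forall>i. \<psi> (Y i) \<in> FA0) \<and> (\<forall>i. \<psi> (Z i) \<in> FA1)"

definition is_ideal :: "'k::field fpoly set \<Rightarrow> bool" where
  "is_ideal J \<longleftrightarrow> J \<subseteq> FA \<and> pzero \<in> J \<and>
     (\<forall>f\<in>J. \<forall>g\<in>J. padd f g \<in> J) \<and>
     (\<forall>f\<in>J. \<forall>h\<in>FA. pmul h f \<in> J \<and> pmul f h \<in> J)"

definition is_T2_ideal :: "'k::field fpoly set \<Rightarrow> bool" where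
  "is_T2_ideal J \<longleftrightarrow> is_ideal J \<and> (\<forall>\<psi> f. graded_endo \<psi> \<longrightarrow> f \<in> J \<longrightarrow> psubst \<psi> f \<in> J)"

definition T2_gen :: "'k::field fpoly set \<Rightarrow> 'k fpoly set" where
  "T2_gen G = \<Inter>{J. is_T2_ideal J \<and> G \<subseteq> J}"

text \<open>Basis of E \<otimes> E: e_S \<otimes> e_T for finite S, T \<subseteq> nat, where e_S = e_{i1}...e_{ik},
  i1 < ... < ik.  An element is a finitely supported coefficient function.\<close>
type_synonym 'k alg = "nat set \<times> nat set \<Rightarrow> 'k"

definition AA :: "'k::field alg set" where
  "AA = {a. finite {st. a st \<noteq> 0} \<and> (\<forall>S T. a (S, T) \<noteq> 0 \<longrightarrow> finite S \<and> finite T)}"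

text \<open>Sign with e_S1 e_S2 = gsign S1 S2 e_{S1 \<union> S2} for disjoint S1, S2.\<close>
definition gsign :: "nat set \<Rightarrow> nat set \<Rightarrow> 'k::field" where
  "gsign S1 S2 = (- 1) ^ card {(i, j). i \<in> S1 \<and> j \<in> S2 \<and> j < i}"

text \<open>(e_S1 \<otimes> e_T1)(e_S2 \<otimes> e_T2) = (e_S1 e_S2) \<otimes> (e_T1 e_T2).\<close>
definition amul :: "'k::field alg \<Rightarrow> 'k alg \<Rightarrow> 'k alg" where
  "amul a b = (\<lambda>(S, T). if finite S \<and> finite T then
     (\<Sum>S1\<in>Pow S. \<Sum>T1\<in>Pow T. gsign S1 (S - S1) * gsign T1 (T - T1) * a (S1, T1) * b (S - S1, T - T1))
     else 0)"

definition aone :: "'k::field alg" where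
  "aone = (\<lambda>(S, T). if S = {} \<and> T = {} then 1 else 0)"

text \<open>Grading of E_{0*} \<otimes> E_0: A_0 = E \<otimes> E^(0), A_1 = E \<otimes> E^(1).\<close>
definition AA0 :: "'k::field alg set" where
  "AA0 = {a \<in> AA. \<forall>S T. a (S, T) \<noteq> 0 \<longrightarrow> even (card T)}"
definition AA1 :: "'k::field alg set" where
  "AA1 = {a \<in> AA. \<forall>S T. a (S, T) \<noteq> 0 \<longrightarrow> odd (card T)}"

definition amon :: "(var \<Rightarrow> 'k::field alg) \<Rightarrow> var list \<Rightarrow> 'k alg" where
  "amon \<phi> w = foldr (\<lambda>x acc. amul (\<phi> x) acc) w aone"

definition aeval :: "(var \<Rightarrow> 'k::field alg) \<Rightarrow> 'k fpoly \<Rightarrow> 'k alg" where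
  "aeval \<phi> f = (\<lambda>st. \<Sum>w\<in>{w. f w \<noteq> 0}. f w * amon \<phi> w st)"

definition graded_subst :: "(var \<Rightarrow> 'k::field alg) \<Rightarrow> bool" where
  "graded_subst \<phi> \<longleftrightarrow> (\<forall>i. \<phi> (Y i) \<in> AA0) \<and> (\<forall>i. \<phi> (Z i) \<in> AA1)"

definition T2_A :: "'k::field fpoly set" where
  "T2_A = {f \<in> FA. \<forall>\<phi>. graded_subst \<phi> \<longrightarrow> aeval \<phi> f = (\<lambda>st. 0)}"

definition gens_I :: "'k::field fpoly set" where
  "gens_I =
    {pcomm (pcomm (y 1) (y 2)) (y 3), pcomm (pcomm (y 1) (y 2)) (z 3),
     pcomm (pcomm (y 1) (z 2)) (y 3),
     pjor (pcomm (y 1) (z 2)) (z 3),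
     pcomm (pjor (z 1) (z 2)) (z 3),
     psub (pmul (pjor (z 1) (z 2)) (pjor (z 3) (z 4))) (pmul (pjor (z 1) (z 3)) (pjor (z 2) (z 4))),
     psub (pmul (pcomm (y 1) (z 2)) (pjor (z 3) (z 4))) (pmul (pcomm (y 1) (z 3)) (pjor (z 2) (z 4)))}
   \<union> {padd (pmul (pcomm x1 (y 2)) (pcomm (y 3) x4)) (pmul (pcomm x1 (y 3)) (pcomm (y 2) x4)) | x1 x4.
        x1 \<in> {y 1, z 1} \<and> x4 \<in> {y 4, z 4}}"

definition gens_p :: "nat \<Rightarrow> 'k::field fpoly set" where
  "gens_p p =
    {pmul (pmul (pprod (map (\<lambda>i. pcomm (y i) (z 1)) [1..<2*k-1])) (pjor (z 2) (z 1))) (ppow (z 1) (2*n))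
       | k n. k \<ge> 1 \<and> 2*n + 2*k - 1 = p}
   \<union> {pmul (pprod (map (\<lambda>i. pcomm (y i) (z 1)) [1..<2*k])) (ppow (z 1) (2*n))
       | k n. k \<ge> 1 \<and> 2*n + 2*k - 1 = p}"

definition I_ideal :: "'k::field fpoly set" where
  "I_ideal = T2_gen gens_I"

definition I_p_ideal :: "nat \<Rightarrow> 'k::field fpoly set" where
  "I_p_ideal p = T2_gen (gens_I \<union> gens_p p)"

end

theory Submission
  imports Defs "HOL-Computational_Algebra.Computational_Algebra" "HOL-Library.Nat_Bijection"
begin

text \<open>
  Call \<open>z \<circ> z'\<close>, respectively \<open>[v, w]\<close> unless both variables are odd, the bracket of two variables.
  If \<open>E \<otimes> E\<close> is evaluated at \<open>v = g v + t v\<close> with \<open>g v\<close> even and \<open>t v\<close> odd in the left factor, then every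
  bracket of \<open>v\<close> and \<open>w\<close> equals \<open>2 (t v) (t w)\<close>, and the \<open>t v\<close> commute up to sign. So brackets commute with
  variables up to sign, and a product of brackets changes only its sign when its entries are permuted.

  Both facts already follow from (1)-(7). Hence, modulo the identities, every polynomial is a combination of
  products of a word and a string of brackets, where word and string matter only up to order: exchanging two
  letters of the word costs a sign and a further bracket in a shorter word. A repeated \<open>z\<close> in the word
  is half a bracket, a repeated \<open>y\<close> in the string gives \<open>0\<close>, and in characteristic \<open>p\<close> so do \<open>p\<close> copies of one \<open>z\<close>,
  by (8) and (9) with \<open>k = 1\<close>.

  The remaining products are independent on \<open>E \<otimes> E\<close>: scale all \<open>g v\<close> and \<open>t v\<close> by independent elements of the
  infinite field. Among the products with the longest word, the monomial that takes \<open>g\<close> for each letter of the word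
  determines the product.
\<close>

section \<open>The free algebra\<close>

text \<open>\<open>bracket_relations\<close> isolates the two facts about brackets, which are
  reached from two sides. In \<open>E \<otimes> E\<close> they come from commutation signs, and they
  make (1)-(7) vanish. In the quotient of the free algebra by the generated ideal they must come
  from the identities alone. That derivation is the delicate one, since (5)-(7) exchange entries
  only for some patterns of even and odd variables. The other patterns are reached by turning
  brackets around and reversing their order; one of them, \<open>[y, y'] (z \<circ> z')\<close>,
  needs (3) with a product \<open>y z\<close> substituted for the odd variable. For independence,
  separating the products by scalars is not enough: the selected product must also be nonzero.
  Therefore \<open>t z\<close> is a sum of as many commuting square-zero elements as
  \<open>z\<close> has copies in the selected string. Its power is then a factorial times a basis
  element, and the bound \<open>p\<close> on the number of copies keeps the factorial invertible.
  The even part \<open>g z\<close> squares to 0, which agrees with words repeating no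
  \<open>z\<close>.\<close>

lemma FA_supp: "f \<in> FA \<longleftrightarrow> finite {w. f w \<noteq> 0}"
  by (simp add: FA_def)

lemma pzero_FA [simp]: "pzero \<in> FA" by (simp add: FA_def pzero_def)

lemma pone_FA [simp]: "pone \<in> FA"
  by (simp add: FA_def pone_def)

lemma pvar_FA [simp]: "pvar x \<in> FA"
  by (simp add: FA_def pvar_def)

lemma padd_FA [simp]: "f \<in> FA \<Longrightarrow> g \<in> FA \<Longrightarrow> padd f g \<in> FA"
  unfolding FA_def padd_def
  by (auto intro: finite_subset[of _ "{w. f w \<noteq> 0} \<union> {w. g w \<noteq> 0}"])

lemma psub_FA [simp]: "f \<in> FA \<Longrightarrow> g \<in> FA \<Longrightarrow> psub f g \<in> FA"
  unfolding FA_def psub_def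
  by (auto intro: finite_subset[of _ "{w. f w \<noteq> 0} \<union> {w. g w \<noteq> 0}"])

lemma pmul_supp:
  "{w. pmul f g w \<noteq> 0} \<subseteq> (\<lambda>(u, v). u @ v) ` ({w. f w \<noteq> 0} \<times> {w. g w \<noteq> 0})"
proof
  fix w assume "w \<in> {w. pmul f g w \<noteq> 0}"
  then obtain i where "f (take i w) * g (drop i w) \<noteq> 0"
    unfolding pmul_def by (auto elim: sum.not_neutral_contains_not_neutral)
  then have "(take i w, drop i w) \<in> {w. f w \<noteq> 0} \<times> {w. g w \<noteq> 0}" by auto
  then show "w \<in> (\<lambda>(u, v). u @ v) ` ({w. f w \<noteq> 0} \<times> {w. g w \<noteq> 0})"
    by (metis (no_types, lifting) append_take_drop_id case_prod_conv image_eqI)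
qed

lemma pmul_FA [simp]: "f \<in> FA \<Longrightarrow> g \<in> FA \<Longrightarrow> pmul f g \<in> FA"
  unfolding FA_supp by (rule finite_subset[OF pmul_supp]) simp

lemma pcomm_FA [simp]: "f \<in> FA \<Longrightarrow> g \<in> FA \<Longrightarrow> pcomm f g \<in> FA"
  by (simp add: pcomm_def)

lemma pjor_FA [simp]: "f \<in> FA \<Longrightarrow> g \<in> FA \<Longrightarrow> pjor f g \<in> FA"
  by (simp add: pjor_def)

lemma pprod_FA [simp]: "set fs \<subseteq> FA \<Longrightarrow> pprod fs \<in> FA"
  by (induction fs) (auto simp: pprod_def)

lemma ppow_FA [simp]: "f \<in> FA \<Longrightarrow> ppow f n \<in> FA"
  unfolding ppow_def by (rule pprod_FA) auto

lemma pmul_assoc: "pmul (pmul f g) h = pmul f (pmul g h)"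
proof (rule ext)
  fix w :: "var list"
  let ?n = "length w"
  \<comment> \<open>The two cuts lie after \<open>i\<close> and \<open>i + j\<close> letters;
    \<open>k\<close> stands for the length of the last factor, so that the sums take the shape of
    the associativity lemma for power series.\<close>
  define F where "F = (\<lambda>i j (k::nat). f (take i w) * g (take j (drop i w)) * h (drop (i + j) w))"
  have "pmul (pmul f g) h w = (\<Sum>j=0..?n. \<Sum>i=0..j. F i (j - i) (?n - j))"
    unfolding pmul_def atMost_atLeast0 sum_distrib_right F_def
    by (intro sum.cong) (simp_all add: min.absorb1 min.absorb2 drop_take)
  also have "\<dots> = (\<Sum>j=0..?n. \<Sum>i=0..?n - j. F j i (?n - j - i))"
    by (rule fps_mult_assoc_lemma)
  also have "\<dots> = pmul f (pmul g h) w"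
    unfolding pmul_def atMost_atLeast0 sum_distrib_left F_def
    by (intro sum.cong) (simp_all add: mult.assoc add.commute)
  finally show "pmul (pmul f g) h w = pmul f (pmul g h) w" .
qed

text \<open>As a type, the free algebra can be an instance of \<open>ring_1\<close>, so that ring
  and module laws apply without carrier conditions.\<close>

typedef (overloaded) ('k::field) fa = "FA :: 'k fpoly set"
  morphisms coeff_fa Abs_fa by (rule exI[of _ pzero]) simp

setup_lifting type_definition_fa

instantiation fa :: (field) ring_1
begin
lift_definition zero_fa :: "'a fa" is pzero by simp
lift_definition one_fa :: "'a fa" is pone by simp
lift_definition plus_fa :: "'a fa \<Rightarrow> 'a fa \<Rightarrow> 'a fa" is padd by simp
lift_definition minus_fa :: "'a fa \<Rightarrow> 'a fa \<Rightarrow> 'a fa" is psub by simp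
lift_definition uminus_fa :: "'a fa \<Rightarrow> 'a fa" is "\<lambda>f. psub pzero f" by simp
lift_definition times_fa :: "'a fa \<Rightarrow> 'a fa \<Rightarrow> 'a fa" is pmul by simp
instance
proof
  fix a b c :: "'a fa"
  show "a * b * c = a * (b * c)" by transfer (rule pmul_assoc)
  show "1 * a = a"
  proof (transfer, rule ext)
    fix f :: "'a fpoly" and w
    have "pmul pone f w = (\<Sum>i\<le>length w. if i = 0 then f w else 0)"
      unfolding pmul_def pone_def by (intro sum.cong) auto
    then show "pmul pone f w = f w" by simp
  qed
  show "a * 1 = a"
  proof (transfer, rule ext)
    fix f :: "'a fpoly" and w
    have "pmul f pone w = (\<Sum>i\<le>length w. if i = length w then f w else 0)"
      unfolding pmul_def pone_def by (intro sum.cong) auto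
    then show "pmul f pone w = f w" by simp
  qed
  show "a + b + c = a + (b + c)" by transfer (simp add: padd_def add.assoc)
  show "a + b = b + a" by transfer (simp add: padd_def add.commute)
  show "0 + a = a" by transfer (simp add: padd_def pzero_def)
  show "- a + a = 0" by transfer (simp add: padd_def psub_def pzero_def)
  show "a - b = a + - b" by transfer (simp add: padd_def psub_def pzero_def)
  show "(a + b) * c = a * c + b * c"
    by transfer (simp add: padd_def pmul_def distrib_right sum.distrib)
  show "a * (b + c) = a * b + a * c"
    by transfer (simp add: padd_def pmul_def distrib_left sum.distrib)
  show "(0::'a fa) \<noteq> 1" by transfer (auto simp: pzero_def pone_def fun_eq_iff)
qed
end

section \<open>Associative algebras over a field and substitution homomorphisms\<close>

text \<open>A unital algebra over \<open>'k\<close>, encoded by the map from the field to the centre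
  of the ring. The free algebra, \<open>E \<otimes> E\<close> and the relatively free algebra are
  the three instances.\<close>

locale scalars =
  fixes \<kappa> :: "'k::field \<Rightarrow> 'r::ring_1"
  assumes \<kappa>_add: "\<kappa> (a + b) = \<kappa> a + \<kappa> b"
    and \<kappa>_mult: "\<kappa> (a * b) = \<kappa> a * \<kappa> b"
    and \<kappa>_1 [simp]: "\<kappa> 1 = 1"
    and \<kappa>_commute: "\<kappa> a * r = r * \<kappa> a"
begin

lemma \<kappa>_0 [simp]: "\<kappa> 0 = 0"
  using \<kappa>_add[of 0 0] by simp

lemma \<kappa>_minus: "\<kappa> (- a) = - \<kappa> a"
  using \<kappa>_add[of "- a" a] by (simp add: eq_neg_iff_add_eq_0)

lemma \<kappa>_of_nat: "\<kappa> (of_nat n) = of_nat n"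
  by (induction n) (auto simp: \<kappa>_add)

lemma \<kappa>_sum: "\<kappa> (sum f A) = (\<Sum>a\<in>A. \<kappa> (f a))"
  by (induction A rule: infinite_finite_induct) (auto simp: \<kappa>_add)

lemma \<kappa>_left_commute: "r * (\<kappa> a * s) = \<kappa> a * (r * s)"
  by (simp only: mult.assoc[symmetric] \<kappa>_commute[of a r])

lemma \<kappa>_cancel: "c \<noteq> 0 \<Longrightarrow> \<kappa> c * a = \<kappa> c * b \<Longrightarrow> a = b"
proof -
  assume c: "c \<noteq> 0" and eq: "\<kappa> c * a = \<kappa> c * b"
  have inv: "\<kappa> (inverse c) * (\<kappa> c * r) = r" for r
    using c by (simp flip: mult.assoc \<kappa>_mult)
  show "a = b" using arg_cong[OF eq, of "\<lambda>r. \<kappa> (inverse c) * r"] by (simp only: inv)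
qed

sublocale module "\<lambda>c q. \<kappa> c * q"
  by standard (simp_all add: \<kappa>_add \<kappa>_mult distrib_left distrib_right mult.assoc)

definition hom_ext :: "(var \<Rightarrow> 'r) \<Rightarrow> 'k fpoly \<Rightarrow> 'r" where
  "hom_ext \<eta> f = (\<Sum>w\<in>{w. f w \<noteq> 0}. \<kappa> (f w) * prod_list (map \<eta> w))"

lemma hom_ext_superset:
  assumes "finite A" "{w. f w \<noteq> 0} \<subseteq> A"
  shows "hom_ext \<eta> f = (\<Sum>w\<in>A. \<kappa> (f w) * prod_list (map \<eta> w))"
  unfolding hom_ext_def using assms by (intro sum.mono_neutral_left) auto

lemma hom_ext_padd:
  assumes "f \<in> FA" "g \<in> FA"
  shows "hom_ext \<eta> (padd f g) = hom_ext \<eta> f + hom_ext \<eta> g"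
proof -
  let ?A = "{w. f w \<noteq> 0} \<union> {w. g w \<noteq> 0}"
  have "finite ?A" using assms by (simp add: FA_def)
  moreover have "{w. padd f g w \<noteq> 0} \<subseteq> ?A" by (auto simp: padd_def)
  ultimately show ?thesis
    by (simp add: hom_ext_superset[of ?A] padd_def \<kappa>_add distrib_right sum.distrib)
qed

lemma hom_ext_psub:
  assumes "f \<in> FA" "g \<in> FA"
  shows "hom_ext \<eta> (psub f g) = hom_ext \<eta> f - hom_ext \<eta> g"
proof -
  have "padd (psub f g) g = f" by (simp add: padd_def psub_def)
  then show ?thesis using hom_ext_padd[of "psub f g" g \<eta>] assms by simp
qed

lemma hom_ext_pzero [simp]: "hom_ext \<eta> pzero = 0"
  by (simp add: hom_ext_def pzero_def)

lemma hom_ext_pone [simp]: "hom_ext \<eta> pone = 1"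
  by (simp add: hom_ext_superset[of "{[]}"] pone_def)

lemma hom_ext_pvar [simp]: "hom_ext \<eta> (pvar x) = \<eta> x"
  by (simp add: hom_ext_superset[of "{[x]}"] pvar_def)

text \<open>A word with a cut position is the same as a pair of words, which turns the convolution
  into a double sum. Cuts outside the product of the two supports contribute 0.\<close>

lemma hom_ext_pmul:
  assumes "f \<in> FA" "g \<in> FA"
  shows "hom_ext \<eta> (pmul f g) = hom_ext \<eta> f * hom_ext \<eta> g"
proof -
  let ?f = "{w. f w \<noteq> 0}" and ?g = "{w. g w \<noteq> 0}"
  let ?W = "(\<lambda>(u, v). u @ v) ` (?f \<times> ?g)"
  let ?P = "\<lambda>w. prod_list (map \<eta> w)"
  define H where "H = (\<lambda>u v. \<kappa> (f u * g v) * ?P (u @ v))"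
  have fin: "finite ?f" "finite ?g" "finite ?W" using assms by (simp_all add: FA_def)
  have "hom_ext \<eta> (pmul f g) = (\<Sum>w\<in>?W. \<Sum>i\<le>length w. H (take i w) (drop i w))"
    by (subst hom_ext_superset[OF fin(3) pmul_supp])
      (simp add: pmul_def \<kappa>_sum sum_distrib_right H_def del: map_append)
  also have "\<dots> = (\<Sum>(w, i)\<in>Sigma ?W (\<lambda>w. {..length w}). H (take i w) (drop i w))"
    using fin by (intro sum.Sigma) auto
  also have "\<dots> = (\<Sum>(w, i)\<in>(\<lambda>(u, v). (u @ v, length u)) ` (?f \<times> ?g). H (take i w) (drop i w))"
  proof (rule sum.mono_neutral_right)
    show "finite (Sigma ?W (\<lambda>w. {..length w}))" using fin by auto
    show "(\<lambda>(u, v). (u @ v, length u)) ` (?f \<times> ?g) \<subseteq> Sigma ?W (\<lambda>w. {..length w})" by auto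
    have "H (take i w) (drop i w) = 0"
      if "i \<le> length w" "(w, i) \<notin> (\<lambda>(u, v). (u @ v, length u)) ` (?f \<times> ?g)" for w i
    proof -
      have "(take i w, drop i w) \<notin> ?f \<times> ?g"
        using that imageI[of "(take i w, drop i w)" "?f \<times> ?g" "\<lambda>(u, v). (u @ v, length u)"]
        by (auto simp: min.absorb2)
      then have "f (take i w) * g (drop i w) = 0" by auto
      then show ?thesis unfolding H_def by (metis \<kappa>_0 mult_zero_left)
    qed
    then show "\<forall>x\<in>Sigma ?W (\<lambda>w. {..length w}) - (\<lambda>(u, v). (u @ v, length u)) ` (?f \<times> ?g).
      (case x of (w, i) \<Rightarrow> H (take i w) (drop i w)) = 0"
      by auto
  qed
  also have "\<dots> = (\<Sum>(u, v)\<in>?f \<times> ?g. H u v)"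
  proof -
    have "inj_on (\<lambda>(u, v). (u @ v, length u)) (?f \<times> ?g)" by (rule inj_onI) auto
    from sum.reindex[OF this, of "\<lambda>(w, i). H (take i w) (drop i w)"]
    show ?thesis by (simp only: comp_def case_prod_unfold fst_conv snd_conv append_eq_conv_conj
       append_take_drop_id) simp
  qed
  also have "\<dots> = (\<Sum>u\<in>?f. \<Sum>v\<in>?g. H u v)"
    by (simp only: sum.cartesian_product)
  also have "\<dots> = (\<Sum>u\<in>?f. \<Sum>v\<in>?g. (\<kappa> (f u) * ?P u) * (\<kappa> (g v) * ?P v))"
  proof (intro sum.cong refl)
    fix u v
    show "H u v = (\<kappa> (f u) * ?P u) * (\<kappa> (g v) * ?P v)"
      unfolding H_def \<kappa>_mult map_append prod_list.append mult.assoc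
      by (simp only: \<kappa>_left_commute[of "?P u"])
  qed
  also have "\<dots> = hom_ext \<eta> f * hom_ext \<eta> g"
    by (simp add: hom_ext_def sum_product)
  finally show ?thesis .
qed

lemma hom_ext_pcomm:
  "f \<in> FA \<Longrightarrow> g \<in> FA \<Longrightarrow> hom_ext \<eta> (pcomm f g) = hom_ext \<eta> f * hom_ext \<eta> g - hom_ext \<eta> g * hom_ext \<eta> f"
  by (simp add: pcomm_def hom_ext_psub hom_ext_pmul)

lemma hom_ext_pjor:
  "f \<in> FA \<Longrightarrow> g \<in> FA \<Longrightarrow> hom_ext \<eta> (pjor f g) = hom_ext \<eta> f * hom_ext \<eta> g + hom_ext \<eta> g * hom_ext \<eta> f"
  by (simp add: pjor_def hom_ext_padd hom_ext_pmul)

lemma hom_ext_pprod: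
  "set fs \<subseteq> FA \<Longrightarrow> hom_ext \<eta> (pprod fs) = prod_list (map (hom_ext \<eta>) fs)"
proof (induction fs)
  case (Cons f fs)
  have "pprod (f # fs) = pmul f (pprod fs)" by (simp add: pprod_def)
  with Cons show ?case by (simp add: hom_ext_pmul)
qed (simp add: pprod_def)

lemma hom_ext_ppow: "f \<in> FA \<Longrightarrow> hom_ext \<eta> (ppow f n) = hom_ext \<eta> f ^ n"
  unfolding ppow_def by (subst hom_ext_pprod) auto

lemmas hom_ext_simps =
  hom_ext_padd hom_ext_psub hom_ext_pmul hom_ext_pcomm hom_ext_pjor hom_ext_pprod hom_ext_ppow

end

lift_definition scal_fa :: "'k::field \<Rightarrow> 'k fa" is "\<lambda>c w. if w = [] then c else 0"
  by (simp add: FA_def)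

lemma coeff_scal_fa_times: "coeff_fa (scal_fa c * f) w = c * coeff_fa f w"
proof transfer
  fix c :: 'a and f :: "'a fpoly" and w
  have "pmul (\<lambda>w. if w = [] then c else 0) f w = (\<Sum>i\<le>length w. if i = 0 then c * f w else 0)"
    unfolding pmul_def by (intro sum.cong) auto
  then show "pmul (\<lambda>w. if w = [] then c else 0) f w = c * f w" by simp
qed

lemma coeff_times_scal_fa: "coeff_fa (f * scal_fa c) w = c * coeff_fa f w"
proof transfer
  fix c :: 'a and f :: "'a fpoly" and w
  have "pmul f (\<lambda>w. if w = [] then c else 0) w = (\<Sum>i\<le>length w. if i = length w then c * f w else 0)"
    unfolding pmul_def by (intro sum.cong) auto
  then show "pmul f (\<lambda>w. if w = [] then c else 0) w = c * f w" by simp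
qed

lemma fa_eqI: "(\<And>w. coeff_fa f w = coeff_fa g w) \<Longrightarrow> f = g"
  by (metis coeff_fa_inject ext)

interpretation fa: scalars "scal_fa :: 'k::field \<Rightarrow> 'k fa"
proof
  fix a b :: 'k and r :: "'k fa"
  show "scal_fa (a + b) = scal_fa a + scal_fa b"
    by transfer (auto simp: padd_def)
  show "scal_fa (a * b) = scal_fa a * scal_fa b"
    by (rule fa_eqI) (simp add: coeff_scal_fa_times, transfer, simp)
  show "(scal_fa 1 :: 'k fa) = 1" by transfer (auto simp: pone_def)
  show "scal_fa a * r = r * scal_fa a"
    by (rule fa_eqI) (simp add: coeff_scal_fa_times coeff_times_scal_fa)
qed

lift_definition var_fa :: "var \<Rightarrow> 'k::field fa" is pvar by simp

lemma coeff_sum_fa: "coeff_fa (sum F A) w = (\<Sum>a\<in>A. coeff_fa (F a) w)"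
  by (induction A rule: infinite_finite_induct)
    (auto simp: plus_fa.rep_eq padd_def zero_fa.rep_eq pzero_def)

lemma coeff_prod_list_fa: "coeff_fa (prod_list fs) = pprod (map coeff_fa fs)"
  by (induction fs) (auto simp: times_fa.rep_eq one_fa.rep_eq pprod_def)

lemma psubst_eq_hom_ext:
  assumes "\<And>v. \<psi> v \<in> FA"
  shows "psubst \<psi> f = coeff_fa (fa.hom_ext (\<lambda>v. Abs_fa (\<psi> v)) f)"
  using assms unfolding psubst_def fa.hom_ext_def
  by (auto simp: coeff_sum_fa coeff_scal_fa_times coeff_prod_list_fa comp_def Abs_fa_inverse)

context scalars
begin

definition hom :: "(var \<Rightarrow> 'r) \<Rightarrow> 'k fa \<Rightarrow> 'r" where
  "hom \<eta> f = hom_ext \<eta> (coeff_fa f)"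

lemma hom_add [simp]: "hom \<eta> (f + g) = hom \<eta> f + hom \<eta> g"
  by (simp add: hom_def plus_fa.rep_eq hom_ext_padd coeff_fa)

lemma hom_mult [simp]: "hom \<eta> (f * g) = hom \<eta> f * hom \<eta> g"
  by (simp add: hom_def times_fa.rep_eq hom_ext_pmul coeff_fa)

lemma hom_diff [simp]: "hom \<eta> (f - g) = hom \<eta> f - hom \<eta> g"
  by (simp add: hom_def minus_fa.rep_eq hom_ext_psub coeff_fa)

lemma hom_0 [simp]: "hom \<eta> 0 = 0"
  by (simp add: hom_def zero_fa.rep_eq)

lemma hom_1 [simp]: "hom \<eta> 1 = 1"
  by (simp add: hom_def one_fa.rep_eq)

lemma hom_var [simp]: "hom \<eta> (var_fa v) = \<eta> v"
  by (simp add: hom_def var_fa.rep_eq)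

lemma hom_scal [simp]: "hom \<eta> (scal_fa c) = \<kappa> c"
  unfolding hom_def scal_fa.rep_eq by (subst hom_ext_superset[of "{[]}"]) (simp_all add: subset_iff)

lemma hom_sum: "hom \<eta> (sum F A) = (\<Sum>a\<in>A. hom \<eta> (F a))"
  by (induction A rule: infinite_finite_induct) auto

lemma hom_prod_list: "hom \<eta> (prod_list fs) = prod_list (map (hom \<eta>) fs)"
  by (induction fs) auto

text \<open>Composing substitutions is what carries an identity of \<open>E \<otimes> E\<close>
  through a graded endomorphism.\<close>

lemma hom_hom: "hom \<eta> (fa.hom \<psi> f) = hom (\<lambda>v. hom \<eta> (\<psi> v)) f"
proof -
  have "hom \<eta> (fa.hom \<psi> f) = (\<Sum>w | coeff_fa f w \<noteq> 0. \<kappa> (coeff_fa f w) * prod_list (map (hom \<eta>) (map \<psi> w)))"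
    unfolding fa.hom_def fa.hom_ext_def by (simp add: hom_sum hom_prod_list)
  then show ?thesis by (simp add: hom_def hom_ext_def comp_def)
qed

end

lemma pmul_pvar:
  "pmul (pvar x) g w = (case w of [] \<Rightarrow> 0 | a # w' \<Rightarrow> if a = x then g w' else 0)"
proof (cases w)
  case (Cons a w')
  have "pmul (pvar x) g w = (\<Sum>i\<le>length w'. pvar x (a # take i w') * g (drop i w'))"
    unfolding pmul_def Cons list.size(4) add_Suc_right add_0_right sum.atMost_Suc_shift
    by (simp add: pvar_def)
  also have "\<dots> = (\<Sum>i\<le>length w'. if i = 0 then (if a = x then g w' else 0) else 0)"
    by (intro sum.cong) (auto simp: pvar_def)
  finally show ?thesis by (simp add: Cons)
qed (simp add: pmul_def pvar_def)

text \<open>Applied to the quotient map, this makes the class of \<open>f\<close> the value of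
  \<open>f\<close> at the classes of the variables.\<close>

lemma fa_as_sum: "f = fa.hom var_fa f"
proof (rule fa_eqI)
  fix w
  have pv: "pprod (map pvar u) = (\<lambda>w. if w = u then 1 else (0::'a))" for u :: "var list"
    by (induction u) (auto simp: pprod_def pone_def pmul_pvar fun_eq_iff split: list.split)
  have "finite {u. coeff_fa f u \<noteq> 0}" using coeff_fa[of f] by (simp add: FA_def)
  then have "(\<Sum>u | coeff_fa f u \<noteq> 0. coeff_fa f u * (if w = u then 1 else 0)) = coeff_fa f w"
    by (simp add: if_distrib cong: if_cong)
  then show "coeff_fa f w = coeff_fa (fa.hom var_fa f) w"
    by (simp add: fa.hom_def fa.hom_ext_def coeff_sum_fa coeff_scal_fa_times coeff_prod_list_fa
        comp_def var_fa.rep_eq pv)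
qed

section \<open>The algebra \<open>E \<otimes> E\<close>\<close>

lemma AA_iff: "a \<in> AA \<longleftrightarrow> finite {st. a st \<noteq> 0} \<and> (\<forall>S T. a (S, T) \<noteq> 0 \<longrightarrow> finite S \<and> finite T)"
  by (simp add: AA_def)

lemma amul_supp:
  assumes "amul a b (S, T) \<noteq> 0"
  obtains S1 T1 S2 T2 where "a (S1, T1) \<noteq> 0" "b (S2, T2) \<noteq> 0" "S = S1 \<union> S2" "T = T1 \<union> T2"
    "S1 \<inter> S2 = {}" "T1 \<inter> T2 = {}" "finite S" "finite T"
proof -
  from assms have fin: "finite S" "finite T" by (auto simp: amul_def split: if_splits)
  from assms obtain S1 where S1: "S1 \<in> Pow S" "(\<Sum>T1\<in>Pow T. gsign S1 (S - S1) * gsign T1 (T - T1) * a (S1, T1) * b (S - S1, T - T1)) \<noteq> 0"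
    by (auto simp: amul_def split: if_splits elim: sum.not_neutral_contains_not_neutral)
  then obtain T1 where "T1 \<in> Pow T" "gsign S1 (S - S1) * gsign T1 (T - T1) * a (S1, T1) * b (S - S1, T - T1) \<noteq> 0"
    by (auto elim: sum.not_neutral_contains_not_neutral)
  with S1(1) fin show thesis by (intro that[of S1 T1 "S - S1" "T - T1"]) auto
qed

lemma amul_AA: assumes "a \<in> AA" "b \<in> AA" shows "amul a b \<in> AA"
proof -
  have "{st. amul a b st \<noteq> 0} \<subseteq> (\<lambda>((S1, T1), (S2, T2)). (S1 \<union> S2, T1 \<union> T2)) ` ({st. a st \<noteq> 0} \<times> {st. b st \<noteq> 0})"
  proof
    fix st assume "st \<in> {st. amul a b st \<noteq> 0}"
    then have "amul a b (fst st, snd st) \<noteq> 0" by simp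
    then obtain S1 T1 S2 T2 where "a (S1, T1) \<noteq> 0" "b (S2, T2) \<noteq> 0" "fst st = S1 \<union> S2" "snd st = T1 \<union> T2"
      by (rule amul_supp)
    then show "st \<in> (\<lambda>((S1, T1), (S2, T2)). (S1 \<union> S2, T1 \<union> T2)) ` ({st. a st \<noteq> 0} \<times> {st. b st \<noteq> 0})"
      by (intro image_eqI[of _ _ "((S1, T1), (S2, T2))"]) (auto simp: prod_eq_iff)
  qed
  moreover have "finite ({st. a st \<noteq> 0} \<times> {st. b st \<noteq> 0})" using assms by (simp add: AA_iff)
  ultimately have "finite {st. amul a b st \<noteq> 0}" by (rule finite_subset[OF _ finite_imageI])
  then show ?thesis by (auto simp: AA_iff elim: amul_supp)
qed

lemma sum_sum_eq_single:
  assumes "finite A" "finite B" "a \<in> A" "b \<in> B"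
    and "\<And>x u. x \<in> A \<Longrightarrow> u \<in> B \<Longrightarrow> (x, u) \<noteq> (a, b) \<Longrightarrow> F x u = 0"
  shows "(\<Sum>x\<in>A. \<Sum>u\<in>B. F x u) = F a b"
proof -
  have "(\<Sum>x\<in>A. \<Sum>u\<in>B. F x u) = (\<Sum>p\<in>A \<times> B. if p = (a, b) then F a b else 0)"
    unfolding sum.cartesian_product using assms(5) by (intro sum.cong) auto
  then show ?thesis using assms by simp
qed

lemma gsign_empty [simp]: "gsign {} S = 1" "gsign S {} = 1"
  by (simp_all add: gsign_def)

lemma amul_aone_left: assumes "a \<in> AA" shows "amul aone a = a"
proof (rule ext, clarify)
  fix S T
  show "amul aone a (S, T) = a (S, T)"
  proof (cases "finite S \<and> finite T")
    case True
    then show ?thesis unfolding amul_def aone_def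
      by (simp only: prod.case simp_thms if_True, subst sum_sum_eq_single[of _ _ "{}" "{}"])
        (auto split: if_splits)
  next
    case False
    then show ?thesis using assms by (auto simp: amul_def AA_iff)
  qed
qed

lemma amul_aone_right: assumes "a \<in> AA" shows "amul a aone = a"
proof (rule ext, clarify)
  fix S T
  show "amul a aone (S, T) = a (S, T)"
  proof (cases "finite S \<and> finite T")
    case True
    then show ?thesis unfolding amul_def aone_def
      by (simp only: prod.case simp_thms if_True, subst sum_sum_eq_single[of _ _ "S" "T"])
        (auto split: if_splits)
  next
    case False
    then show ?thesis using assms by (auto simp: amul_def AA_iff)
  qed
qed

section \<open>Ring structure, reduced to basis elements\<close>

typedef (overloaded) ('k::field) ee = "AA :: 'k alg set"
  morphisms coeff_ee Abs_ee by (rule exI[of _ "\<lambda>_. 0"]) (simp add: AA_def)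

setup_lifting type_definition_ee

lemma finite_supp_ee: "finite {st. coeff_ee a st \<noteq> 0}"
  using coeff_ee[of a] by (simp add: AA_iff)

lemma coeff_ee_finite: "coeff_ee a (S, T) \<noteq> 0 \<Longrightarrow> finite S \<and> finite T"
  using coeff_ee[of a] by (auto simp: AA_iff)

lemma ee_eqI: "(\<And>S T. coeff_ee f (S, T) = coeff_ee g (S, T)) \<Longrightarrow> f = g"
  by (metis coeff_ee_inject ext surj_pair)

instantiation ee :: (field) ab_group_add
begin
lift_definition zero_ee :: "'a ee" is "\<lambda>_. 0" by (simp add: AA_def)
lift_definition plus_ee :: "'a ee \<Rightarrow> 'a ee \<Rightarrow> 'a ee" is "\<lambda>a b st. a st + b st"
proof -
  fix a b :: "'a alg" assume ab: "a \<in> AA" "b \<in> AA"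
  then have "finite ({st. a st \<noteq> 0} \<union> {st. b st \<noteq> 0})" by (simp add: AA_iff)
  then have "finite {st. a st + b st \<noteq> 0}" by (rule rev_finite_subset) auto
  moreover have "finite S \<and> finite T" if "a (S, T) + b (S, T) \<noteq> 0" for S T
  proof -
    from that have "a (S, T) \<noteq> 0 \<or> b (S, T) \<noteq> 0" by auto
    with ab show ?thesis unfolding AA_iff by blast
  qed
  ultimately show "(\<lambda>st. a st + b st) \<in> AA" by (simp add: AA_iff)
qed
lift_definition uminus_ee :: "'a ee \<Rightarrow> 'a ee" is "\<lambda>a st. - a st" by (simp add: AA_iff)
definition minus_ee :: "'a ee \<Rightarrow> 'a ee \<Rightarrow> 'a ee" where "minus_ee a b = a + - b"
instance
proof
  fix a b c :: "'a ee"
  show "a + b + c = a + (b + c)" by transfer (simp add: add.assoc)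
  show "a + b = b + a" by transfer (simp add: add.commute)
  show "0 + a = a" by transfer simp
  show "- a + a = 0" by transfer simp
  show "a - b = a + - b" by (simp add: minus_ee_def)
qed
end

instantiation ee :: (field) "{one, times}"
begin
lift_definition one_ee :: "'a ee" is aone
  by (auto simp: AA_iff aone_def intro: finite_subset[of _ "{({}, {})}"] split: if_splits)
lift_definition times_ee :: "'a ee \<Rightarrow> 'a ee \<Rightarrow> 'a ee" is amul by (rule amul_AA)
instance ..
end

lemma ee_distrib:
  fixes a b c :: "'k::field ee"
  shows "(a + b) * c = a * c + b * c" "a * (b + c) = a * b + a * c"
  by (transfer, auto simp: amul_def fun_eq_iff algebra_simps sum.distrib)+

text \<open>\<open>emon S T c\<close> is \<open>c\<close> times the basis element \<open>e_S \<otimes> e_T\<close>, and \<open>0\<close> when \<open>S\<close> or \<open>T\<close> is infinite.\<close>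
lift_definition emon :: "nat set \<Rightarrow> nat set \<Rightarrow> 'k::field \<Rightarrow> 'k ee" is
  "\<lambda>S T c st. if st = (S, T) \<and> finite S \<and> finite T then c else 0"
proof -
  fix S T :: "nat set" and c :: 'k
  show "(\<lambda>st. if st = (S, T) \<and> finite S \<and> finite T then c else 0) \<in> AA"
    by (auto simp: AA_iff intro: finite_subset[of _ "{(S, T)}"])
qed

lemma coeff_emon: "coeff_ee (emon S T c) st = (if st = (S, T) \<and> finite S \<and> finite T then c else 0)"
  by (simp add: emon.rep_eq)

text \<open>The new basis element does not occur in \<open>a\<close>, so nothing cancels and the
  support of \<open>a\<close> stays inside that of the sum. This lets homogeneity pass to
  \<open>a\<close> in the bihomogeneous version.\<close>

lemma ee_induct [case_names zero add]:
  fixes a :: "'k::field ee"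
  assumes 0: "P 0"
    and add: "\<And>a S T c. P a \<Longrightarrow> finite S \<Longrightarrow> finite T \<Longrightarrow> coeff_ee a (S, T) = 0 \<Longrightarrow> P (a + emon S T c)"
  shows "P a"
proof -
  have "P a" if "finite A" "{st. coeff_ee a st \<noteq> 0} = A" for A and a :: "'k ee"
    using that
  proof (induction A arbitrary: a rule: finite_induct)
    case empty
    then have "a = 0" by (intro ee_eqI) (auto simp: zero_ee.rep_eq)
    with 0 show ?case by simp
  next
    case (insert st A)
    obtain S T where st: "st = (S, T)" by fastforce
    define c where "c = coeff_ee a (S, T)"
    have c: "c \<noteq> 0" using insert.prems st by (auto simp: c_def)
    then have fin: "finite S" "finite T" using coeff_ee_finite[of a S T] by (auto simp: c_def)
    define b where "b = a + emon S T (- c)"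
    have b: "coeff_ee b u = (if u = (S, T) then 0 else coeff_ee a u)" for u
      using fin by (simp add: b_def plus_ee.rep_eq coeff_emon c_def)
    have "{st. coeff_ee b st \<noteq> 0} = A"
      using insert.prems insert.hyps st by (auto simp: b)
    from insert.IH[OF this] have "P b" .
    moreover have "a = b + emon S T c"
      using fin by (intro ee_eqI) (auto simp: plus_ee.rep_eq b coeff_emon c_def)
    ultimately show ?case using add[of b S T c] fin b by simp
  qed
  from this[OF finite_supp_ee refl] show ?thesis .
qed

lemma emon_times_emon:
  fixes c d :: "'k::field"
  assumes "finite S1" "finite T1" "finite S2" "finite T2"
  shows "emon S1 T1 c * emon S2 T2 d =
    (if S1 \<inter> S2 = {} \<and> T1 \<inter> T2 = {}
     then emon (S1 \<union> S2) (T1 \<union> T2) (gsign S1 S2 * gsign T1 T2 * c * d) else 0)"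
proof (rule ee_eqI)
  fix S T :: "nat set"
  let ?r = "if S1 \<inter> S2 = {} \<and> T1 \<inter> T2 = {}
     then emon (S1 \<union> S2) (T1 \<union> T2) (gsign S1 S2 * gsign T1 T2 * c * d) else 0"
  let ?m = "emon S1 T1 c * emon S2 T2 d"
  show "coeff_ee ?m (S, T) = coeff_ee ?r (S, T)"
  proof (cases "S1 \<inter> S2 = {} \<and> T1 \<inter> T2 = {} \<and> S = S1 \<union> S2 \<and> T = T1 \<union> T2")
    case True
    then have fin: "finite S" "finite T" using assms by auto
    have "S - S1 = S2" "T - T1 = T2" using True by auto
    moreover have "coeff_ee ?m (S, T) = (\<Sum>A\<in>Pow S. \<Sum>B\<in>Pow T. gsign A (S - A) * gsign B (T - B) *
        coeff_ee (emon S1 T1 c) (A, B) * coeff_ee (emon S2 T2 d) (S - A, T - B))"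
      using fin by (simp add: times_ee.rep_eq amul_def)
    moreover have "\<dots> = gsign S1 (S - S1) * gsign T1 (T - T1) *
        coeff_ee (emon S1 T1 c) (S1, T1) * coeff_ee (emon S2 T2 d) (S - S1, T - T1)"
      using fin True by (intro sum_sum_eq_single) (auto simp: coeff_emon)
    ultimately have "coeff_ee ?m (S, T) = gsign S1 S2 * gsign T1 T2 * c * d"
      using assms by (simp add: coeff_emon)
    then show ?thesis using True fin by (auto simp: coeff_emon)
  next
    case False
    have "coeff_ee ?m (S, T) = 0"
    proof (rule ccontr)
      assume "coeff_ee ?m (S, T) \<noteq> 0"
      then have "amul (coeff_ee (emon S1 T1 c)) (coeff_ee (emon S2 T2 d)) (S, T) \<noteq> 0" by (simp add: times_ee.rep_eq)
      then show False
        by (rule amul_supp) (use False in \<open>auto simp: coeff_emon split: if_splits\<close>)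
    qed
    then show ?thesis using False by (auto simp: coeff_emon zero_ee.rep_eq)
  qed
qed

text \<open>Inversions are counted pairwise, so the sign is multiplicative in each argument. Both
  bracketings of a triple product then carry the same three pairwise signs on each tensor factor,
  which gives associativity.\<close>

lemma gsign_Un_left:
  assumes "finite S1" "finite S2" "finite S3" "S1 \<inter> S2 = {}"
  shows "gsign (S1 \<union> S2) S3 = (gsign S1 S3 * gsign S2 S3 :: 'k::field)"
proof -
  let ?P = "\<lambda>A. {(i, j). i \<in> A \<and> j \<in> S3 \<and> j < i}"
  have fin: "finite (?P A)" if "finite A" for A
    by (rule finite_subset[of _ "A \<times> S3"]) (use that assms in auto)
  have "?P (S1 \<union> S2) = ?P S1 \<union> ?P S2" by auto
  moreover have "card (?P S1 \<union> ?P S2) = card (?P S1) + card (?P S2)"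
    by (rule card_Un_disjoint) (use fin assms in auto)
  ultimately show ?thesis unfolding gsign_def by (simp add: power_add)
qed

lemma gsign_Un_right:
  assumes "finite S1" "finite S2" "finite S3" "S2 \<inter> S3 = {}"
  shows "gsign S1 (S2 \<union> S3) = (gsign S1 S2 * gsign S1 S3 :: 'k::field)"
proof -
  let ?P = "\<lambda>A. {(i, j). i \<in> S1 \<and> j \<in> A \<and> j < i}"
  have fin: "finite (?P A)" if "finite A" for A
    by (rule finite_subset[of _ "S1 \<times> A"]) (use that assms in auto)
  have "?P (S2 \<union> S3) = ?P S2 \<union> ?P S3" by auto
  moreover have "card (?P S2 \<union> ?P S3) = card (?P S2) + card (?P S3)"
    by (rule card_Un_disjoint) (use fin assms in auto)
  ultimately show ?thesis unfolding gsign_def by (simp add: power_add)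
qed

text \<open>Each pair from \<open>S1\<close> and \<open>S2\<close> is an inversion in exactly one of
  the two orders.\<close>

lemma gsign_swap:
  assumes "finite S1" "finite S2" "S1 \<inter> S2 = {}"
  shows "gsign S1 S2 = ((- 1) ^ (card S1 * card S2) * gsign S2 S1 :: 'k::field)"
proof -
  let ?A = "{(i, j). i \<in> S1 \<and> j \<in> S2 \<and> j < i}" and ?B = "{(i, j). i \<in> S2 \<and> j \<in> S1 \<and> j < i}"
  have fin: "finite ?A" "finite ?B"
    by (rule finite_subset[of _ "S1 \<times> S2"], use assms in auto)
       (rule finite_subset[of _ "S2 \<times> S1"], use assms in auto)
  have "S1 \<times> S2 = ?A \<union> prod.swap ` ?B" using assms by (force simp: image_iff)
  then have "card S1 * card S2 = card (?A \<union> prod.swap ` ?B)"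
    by (simp add: card_cartesian_product[symmetric])
  also have "\<dots> = card ?A + card (prod.swap ` ?B)"
    by (rule card_Un_disjoint) (use fin in auto)
  also have "card (prod.swap ` ?B) = card ?B" by (rule card_image) auto
  finally have *: "card S1 * card S2 = card ?A + card ?B" .
  have "(- 1 :: 'k) ^ (card ?A + card ?B) * (- 1) ^ card ?B = (- 1) ^ card ?A"
    by (simp add: power_add mult.assoc flip: power_mult_distrib)
  then show ?thesis unfolding gsign_def * by simp
qed

lemma emon_zero [simp]: "emon S T 0 = 0"
  by (rule ee_eqI) (simp add: coeff_emon zero_ee.rep_eq)

lemma ee_times_zero: "(0 :: 'k::field ee) * a = 0" "a * (0 :: 'k ee) = 0"
  by (rule ee_eqI, simp add: times_ee.rep_eq zero_ee.rep_eq amul_def)+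

lemma emon_assoc:
  fixes c1 c2 c3 :: "'k::field"
  assumes "finite S1" "finite T1" "finite S2" "finite T2" "finite S3" "finite T3"
  shows "emon S1 T1 c1 * emon S2 T2 c2 * emon S3 T3 c3 = emon S1 T1 c1 * (emon S2 T2 c2 * emon S3 T3 c3)"
  using assms
  by (auto simp: emon_times_emon ee_times_zero gsign_Un_left gsign_Un_right Un_assoc
      Int_Un_distrib Int_Un_distrib2 mult_ac)

instance ee :: (field) ring_1
proof
  fix a b c :: "'a ee"
  show "a * b * c = a * (b * c)"
  proof (induction a rule: ee_induct)
    case (add a S1 T1 c1)
    note 1 = add
    have "emon S1 T1 c1 * b * c = emon S1 T1 c1 * (b * c)"
    proof (induction b rule: ee_induct)
      case (add b S2 T2 c2)
      note 2 = add
      have "emon S1 T1 c1 * emon S2 T2 c2 * c = emon S1 T1 c1 * (emon S2 T2 c2 * c)"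
      proof (induction c rule: ee_induct)
        case (add c S3 T3 c3)
        then show ?case using 1 2 by (simp add: ee_distrib emon_assoc)
      qed (simp add: ee_times_zero)
      then show ?case using 2 by (simp add: ee_distrib)
    qed (simp add: ee_times_zero)
    then show ?case using 1 by (simp add: ee_distrib)
  qed (simp add: ee_times_zero)
  show "1 * a = a" by transfer (rule amul_aone_left)
  show "a * 1 = a" by transfer (rule amul_aone_right)
  show "(a + b) * c = a * c + b * c" "a * (b + c) = a * b + a * c" by (rule ee_distrib)+
  have "coeff_ee (0 :: 'a ee) ({}, {}) \<noteq> coeff_ee 1 ({}, {})"
    by (simp add: zero_ee.rep_eq one_ee.rep_eq aone_def)
  then show "(0 :: 'a ee) \<noteq> 1" by metis
qed

abbreviation scal_ee :: "'k::field \<Rightarrow> 'k ee" where "scal_ee \<equiv> emon {} {}"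

lemma emon_add: "emon S T (a + b) = emon S T a + emon S T b"
  by (rule ee_eqI) (simp add: coeff_emon plus_ee.rep_eq)

lemma scal_ee_commute: "scal_ee c * a = a * scal_ee c"
proof (induction a rule: ee_induct)
  case (add a S T d)
  then show ?case by (simp add: distrib_left distrib_right emon_times_emon mult.commute)
qed simp

interpretation ee: scalars "scal_ee :: 'k::field \<Rightarrow> 'k ee"
proof
  fix a b :: 'k and r :: "'k ee"
  show "scal_ee (a + b) = scal_ee a + scal_ee b" by (rule emon_add)
  show "scal_ee (a * b) = scal_ee a * scal_ee b" by (simp add: emon_times_emon)
  show "(scal_ee 1 :: 'k ee) = 1" by (rule ee_eqI) (simp add: coeff_emon one_ee.rep_eq aone_def)
  show "scal_ee a * r = r * scal_ee a" by (rule scal_ee_commute)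
qed

lemma scal_ee_emon: "scal_ee c * emon S T d = emon S T (c * d)"
proof (cases "finite S \<and> finite T")
  case False
  then have "emon S T d = 0" for d :: 'a
    by (intro ee_eqI) (auto simp: coeff_emon zero_ee.rep_eq)
  then show ?thesis by simp
qed (simp add: emon_times_emon)

lemma coeff_scal_ee_times: "coeff_ee (scal_ee c * a) st = c * coeff_ee a st"
proof (induction a rule: ee_induct)
  case (add a S T d)
  then show ?case by (simp add: distrib_left plus_ee.rep_eq scal_ee_emon coeff_emon)
qed (simp add: zero_ee.rep_eq)

lemma coeff_sum_ee: "coeff_ee (sum F A) st = (\<Sum>a\<in>A. coeff_ee (F a) st)"
  by (induction A rule: infinite_finite_induct) (auto simp: plus_ee.rep_eq zero_ee.rep_eq)

lemma aeval_eq_hom: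
  assumes "\<And>v. \<phi> v \<in> AA"
  shows "aeval \<phi> f = coeff_ee (ee.hom_ext (\<lambda>v. Abs_ee (\<phi> v)) f)"
proof -
  have "amon \<phi> w = coeff_ee (prod_list (map (\<lambda>v. Abs_ee (\<phi> v)) w))" for w
    using assms by (induction w) (auto simp: amon_def one_ee.rep_eq times_ee.rep_eq Abs_ee_inverse)
  then show ?thesis
    by (auto simp: aeval_def ee.hom_ext_def coeff_sum_ee coeff_scal_ee_times)
qed

section \<open>Commutation signs of bihomogeneous elements\<close>

text \<open>\<open>E^(p) \<otimes> E^(q)\<close>, where \<open>p\<close>, \<open>q\<close> say whether the degree is odd.\<close>
definition bihom :: "bool \<Rightarrow> bool \<Rightarrow> 'k::field ee set" where
  "bihom p q = {a. \<forall>S T. coeff_ee a (S, T) \<noteq> 0 \<longrightarrow> odd (card S) = p \<and> odd (card T) = q}"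

lemma bihom_induct [consumes 1, case_names zero add]:
  fixes a :: "'k::field ee"
  assumes "a \<in> bihom p q" and 0: "P 0"
    and add: "\<And>a S T c. a \<in> bihom p q \<Longrightarrow> P a \<Longrightarrow> finite S \<Longrightarrow> finite T \<Longrightarrow> odd (card S) = p \<Longrightarrow> odd (card T) = q \<Longrightarrow> P (a + emon S T c)"
  shows "P a"
  using assms(1)
proof (induction a rule: ee_induct)
  case zero
  show ?case by (rule 0)
next
  case (add a S T c)
  show ?case
  proof (cases "c = 0")
    case True
    then show ?thesis using add by simp
  next
    case False
    have "coeff_ee (a + emon S T c) (S, T) \<noteq> 0"
      using False add by (simp add: plus_ee.rep_eq coeff_emon)
    then have 1: "odd (card S) = p" "odd (card T) = q" using add.prems by (auto simp: bihom_def)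
    have "a \<in> bihom p q" unfolding bihom_def
    proof clarify
      fix S' T' assume nz: "coeff_ee a (S', T') \<noteq> 0"
      then have "(S', T') \<noteq> (S, T)" using add by auto
      then have "coeff_ee (a + emon S T c) (S', T') \<noteq> 0"
        using nz by (auto simp: plus_ee.rep_eq coeff_emon)
      then show "odd (card S') = p \<and> odd (card T') = q" using add.prems by (auto simp: bihom_def)
    qed
    with add 1 show ?thesis by (intro assms(3)) auto
  qed
qed

text \<open>The tensor product is the ordinary one, so each factor contributes its own sign: the
  total exponent is \<open>p r + q s\<close>.\<close>

lemma bihom_commute:
  fixes a b :: "'k::field ee"
  assumes "a \<in> bihom p q" "b \<in> bihom r s"
  shows "a * b = (if (p \<and> r) = (q \<and> s) then b * a else - (b * a))"
  using assms(1)
proof (induction a rule: bihom_induct)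
  case (add a S1 T1 c1)
  note 1 = add
  have "emon S1 T1 c1 * b = (if (p \<and> r) = (q \<and> s) then b * emon S1 T1 c1 else - (b * emon S1 T1 c1))"
    using assms(2)
  proof (induction b rule: bihom_induct)
    case (add b S2 T2 c2)
    have "emon S1 T1 c1 * emon S2 T2 c2 = scal_ee ((-1) ^ (card S1 * card S2 + card T1 * card T2)) * (emon S2 T2 c2 * emon S1 T1 c1)"
      using 1 add by (auto simp: emon_times_emon scal_ee_emon Int_commute Un_commute power_add
          gsign_swap[of S1 S2] gsign_swap[of T1 T2] mult_ac)
    also have "scal_ee ((-1) ^ (card S1 * card S2 + card T1 * card T2)) = (if (p \<and> r) = (q \<and> s) then 1 else - 1 :: 'k ee)"
      using 1 add by (auto simp: ee.\<kappa>_minus uminus_power_if)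
    finally show ?case using add by (auto simp: distrib_left distrib_right)
  qed simp
  then show ?case using 1 by (auto simp: distrib_left distrib_right)
qed simp

definition part :: "(nat set \<Rightarrow> nat set \<Rightarrow> bool) \<Rightarrow> 'k::field ee \<Rightarrow> 'k ee" where
  "part P a = Abs_ee (\<lambda>(S, T). if P S T then coeff_ee a (S, T) else 0)"

lemma coeff_part: "coeff_ee (part P a) (S, T) = (if P S T then coeff_ee a (S, T) else 0)"
proof -
  have "(\<lambda>(S, T). if P S T then coeff_ee a (S, T) else 0) \<in> AA"
    unfolding AA_iff by (auto intro: finite_subset[OF _ finite_supp_ee[of a]] simp: coeff_ee_finite split: if_splits)
  then show ?thesis by (simp add: part_def Abs_ee_inverse)
qed

section \<open>Relations between brackets\<close>

text \<open>Adjacent transpositions generate all permutations: the first letter is moved to its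
  place and the rest follows by induction. Any reflexive transitive \<open>R\<close> is allowed, so
  the rule covers equality up to sign as well as membership in a span.\<close>

lemma mset_eq_induct_swap:
  assumes refl: "\<And>xs. R xs xs" and trans: "\<And>xs ys zs. R xs ys \<Longrightarrow> R ys zs \<Longrightarrow> R xs zs"
    and swap: "\<And>as v w bs. R (as @ v # w # bs) (as @ w # v # bs)"
    and "mset xs = mset ys"
  shows "R xs ys"
proof -
  have move: "R (as @ v # cs @ bs) (as @ cs @ v # bs)" for as v cs bs
  proof (induction cs arbitrary: as)
    case (Cons c cs)
    from Cons[of "as @ [c]"] swap[of as v c "cs @ bs"] show ?case by (auto intro: trans)
  qed (simp add: refl)
  have "R (pre @ xs) (pre @ ys)" for pre
    using \<open>mset xs = mset ys\<close>
  proof (induction xs arbitrary: pre ys)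
    case (Cons v xs)
    then have "v \<in> set ys" by (metis list.set_intros(1) set_mset_mset)
    then obtain as bs where ys: "ys = as @ v # bs" by (meson split_list)
    with Cons.prems have "mset xs = mset (as @ bs)" by simp
    from Cons.IH[OF this, of "pre @ [v]"] move[of pre v as bs] show ?case
      by (auto simp: ys intro: trans)
  qed (simp add: refl)
  from this[of "[]"] show ?thesis by simp
qed

definition isZ :: "var \<Rightarrow> bool" where "isZ v = (case v of Y _ \<Rightarrow> False | Z _ \<Rightarrow> True)"

lemma isZ_simps [simp]: "\<not> isZ (Y i)" "isZ (Z i)" by (simp_all add: isZ_def)

definition br :: "(var \<Rightarrow> 'r::ring_1) \<Rightarrow> var \<Rightarrow> var \<Rightarrow> 'r" where
  "br x v w = (if isZ v \<and> isZ w then x v * x w + x w * x v else x v * x w - x w * x v)"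

text \<open>The value \<open>0\<close> on lists of odd length lets \<open>brs_swap\<close> hold without a parity assumption.\<close>
fun brs :: "(var \<Rightarrow> 'r::ring_1) \<Rightarrow> var list \<Rightarrow> 'r" where
  "brs x [] = 1"
| "brs x [v] = 0"
| "brs x (v # w # ts) = br x v w * brs x ts"

lemma br_sym: "br x w v = (if isZ v \<and> isZ w then br x v w else - br x v w)"
  by (auto simp: br_def add.commute)

lemma br_YY: "\<not> isZ v \<Longrightarrow> br x v v = 0"
  by (simp add: br_def)

lemma br_ZZ: "isZ v \<Longrightarrow> br x v v = 2 * (x v)\<^sup>2"
  by (simp add: br_def power2_eq_square mult_2)

lemma brs_append_even: "even (length as) \<Longrightarrow> brs x (as @ bs) = brs x as * brs x bs"
  by (induction x as rule: brs.induct) (auto simp: mult.assoc)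

text \<open>Since \<open>z \<circ> z = 2 z^2\<close>, the even powers of \<open>z\<close> in (8) and
  (9) are themselves strings of brackets, up to a power of 2.\<close>

lemma brs_replicate_Z: "brs x (replicate (2 * n) (Z i)) = 2 ^ n * x (Z i) ^ (2 * n)"
proof (induction n)
  case (Suc n)
  have "(x (Z i))\<^sup>2 * 2 ^ n = 2 ^ n * (x (Z i))\<^sup>2"
    using mult_of_nat_commute[of "2 ^ n" "(x (Z i))\<^sup>2"] by simp
  then have "br x (Z i) (Z i) * (2 ^ n * x (Z i) ^ (2 * n)) = 2 ^ Suc n * ((x (Z i))\<^sup>2 * x (Z i) ^ (2 * n))"
    by (simp add: br_ZZ flip: mult.assoc) (simp add: mult.assoc)
  with Suc show ?case by (simp add: power_add power2_eq_square mult.assoc)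
qed simp

text \<open>\<open>br_x\<close> moves a bracket past a letter; \<open>br_br\<close> exchanges the
  inner entries of two adjacent brackets. Together with \<open>br_sym\<close> the latter yields
  every adjacent transposition in a string of entries.\<close>

locale bracket_relations =
  fixes x :: "var \<Rightarrow> 'r::ring_1"
  assumes br_x: "br x v w * x u = (if isZ u \<and> isZ v \<noteq> isZ w then - (x u * br x v w) else x u * br x v w)"
    and br_br: "br x a b * br x c d = (if isZ b \<and> isZ c then br x a c * br x b d else - (br x a c * br x b d))"
begin

text \<open>The transposition lies inside the first bracket, across its right end, or further on;
  these are the three cases of the two-step induction.\<close>

lemma brs_swap: "brs x (as @ v # w # bs) \<in> {brs x (as @ w # v # bs), - brs x (as @ w # v # bs)}"
proof (induction as rule: induct_list012)
  case 1
  then show ?case by (auto simp: br_sym[of x w v])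
next
  case (2 a)
  then show ?case
    by (cases bs) (auto simp: br_br[of a v w] simp flip: mult.assoc)
next
  case (3 a b as)
  then show ?case by auto
qed

text \<open>The sign may stay undetermined, because vanishing and membership in a span do not depend
  on it.\<close>

lemma brs_mset:
  assumes "mset ts = mset ts'"
  shows "brs x ts \<in> {brs x ts', - brs x ts'}"
  by (rule mset_eq_induct_swap[of "\<lambda>ts ts'. brs x ts \<in> {brs x ts', - brs x ts'}"])
    (use brs_swap assms in auto)

lemma br_prod:
  "\<exists>s\<in>{1, - 1}. br x v w * prod_list (map x xs) = s * (prod_list (map x xs) * br x v w)"
proof (induction xs)
  case (Cons u xs)
  then obtain s where s: "s \<in> {1, - 1}" "br x v w * prod_list (map x xs) = s * (prod_list (map x xs) * br x v w)"
    by blast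
  have "br x v w * (x u * q) = (if isZ u \<and> isZ v \<noteq> isZ w then - (x u * (br x v w * q)) else x u * (br x v w * q))" for q
    by (simp add: br_x mult.assoc[symmetric])
  then show ?case using s by (auto simp: mult.assoc)
qed auto

lemma brs_eq_0_repeat_Y:
  assumes "2 \<le> count (mset ts) (Y i)"
  shows "brs x ts = 0"
proof -
  from assms have "{#Y i, Y i#} \<subseteq># mset ts"
    by (metis count_le_replicate_mset_subset_eq numeral_2_eq_2 replicate_mset_0 replicate_mset_Suc)
  then obtain M where "mset ts = {#Y i, Y i#} + M" by (metis subset_mset.le_iff_add)
  moreover obtain ms where "M = mset ms" by (metis ex_mset)
  ultimately have "mset ts = mset (Y i # Y i # ms)" by simp
  from brs_mset[OF this] show ?thesis by (simp add: br_YY)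
qed

end

text \<open>\<open>br_pow\<close> is the case \<open>k = 1\<close>, \<open>p = 2 n + 1\<close> of
  (8) for odd \<open>w\<close> and of (9) for even \<open>w\<close>.\<close>

locale bracket_relations_p = bracket_relations x for x :: "var \<Rightarrow> 'r::ring_1" +
  fixes p :: nat
  assumes odd_p: "odd p"
    and br_pow: "br x w (Z i) * x (Z i) ^ (p - 1) = 0"
begin

lemma brs_eq_0_power:
  assumes "p \<le> count (mset ts) (Z i)" "even (length ts)"
  shows "brs x ts = 0"
proof -
  obtain n where n: "p = 2 * n + 1" using odd_p by (auto elim: oddE)
  from assms(1) have "replicate_mset p (Z i) \<subseteq># mset ts"
    by (metis count_le_replicate_mset_subset_eq)
  then obtain M where M: "mset ts = replicate_mset p (Z i) + M" by (metis subset_mset.le_iff_add)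
  then have "size (mset ts) = p + size M" by simp
  \<comment> \<open>The length is even and \<open>p\<close> is odd, so some letter \<open>w\<close>
    accompanies the \<open>p\<close> copies. It shares the first bracket with one copy; the other
    \<open>p - 1\<close> copies form a power.\<close>
  then have "M \<noteq> {#}" using assms(2) odd_p by (metis add.right_neutral size_empty size_mset)
  then obtain w M' where "M = add_mset w M'" by (metis multiset_cases)
  moreover obtain ms where "M' = mset ms" by (metis ex_mset)
  ultimately have "mset ts = mset ((w # Z i # replicate (2 * n) (Z i)) @ ms)" using M n by simp
  moreover have "brs x ((w # Z i # replicate (2 * n) (Z i)) @ ms) = 0"
  proof -
    have "br x w (Z i) * (2 ^ n * x (Z i) ^ (2 * n)) = 2 ^ n * (br x w (Z i) * x (Z i) ^ (p - 1))"
      using mult_of_nat_commute[of "2 ^ n" "br x w (Z i)"] n by (simp flip: mult.assoc)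
    also have "\<dots> = 0" by (simp only: br_pow mult_zero_right)
    finally show ?thesis
      by (subst brs_append_even) (simp_all add: brs_replicate_Z)
  qed
  ultimately show ?thesis using brs_mset by fastforce
qed

end

context scalars
begin

lemma gens_I_vanish:
  assumes "bracket_relations \<eta>" "f \<in> gens_I"
  shows "hom_ext \<eta> f = 0"
proof -
  interpret bracket_relations \<eta> by fact
  have br: "hom_ext \<eta> (pcomm (pvar v) (pvar w)) = br \<eta> v w" if "\<not> (isZ v \<and> isZ w)" for v w
    using that by (auto simp: hom_ext_pcomm br_def)
  have br': "hom_ext \<eta> (pjor (z i) (z j)) = br \<eta> (Z i) (Z j)" for i j
    by (simp add: hom_ext_pjor br_def)
  note eqs = hom_ext_pcomm[of "pcomm _ _"] hom_ext_pcomm[of "pjor _ _"] hom_ext_pjor[of "pcomm _ _"]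
    hom_ext_psub hom_ext_padd hom_ext_pmul br br'
  show ?thesis
    using assms(2) unfolding gens_I_def
    by (elim UnE insertE emptyE CollectE exE conjE)
      (simp_all add: eqs br_x br_br[of _ "Y 2" "Y 3"] br_br[of _ "Z 2" "Z 3"])
qed

text \<open>Written as a string, each of these polynomials contains \<open>Z 1\<close> exactly
  \<open>2 n + 2 k - 1 = p\<close> times, so every \<open>k\<close> reduces to the same vanishing of
  strings. Replacing the power of \<open>z 1\<close> by brackets costs \<open>2 ^ n\<close>, which
  is invertible.\<close>

lemma gens_p_vanish:
  assumes "bracket_relations_p \<eta> p" "f \<in> gens_p p" "(2 :: 'k) \<noteq> 0"
  shows "hom_ext \<eta> f = 0"
proof -
  interpret bracket_relations_p \<eta> p by fact
  define W where "W = (\<lambda>L. concat (map (\<lambda>i. [Y i, Z 1]) L))"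
  have cnt: "count (mset (W L)) (Z 1) = length L" and len: "even (length (W L))"
    and brs_W: "brs \<eta> (W L) = prod_list (map (\<lambda>i. br \<eta> (Y i) (Z 1)) L)" for L
    by (induction L) (auto simp: W_def)
  have pprod: "hom_ext \<eta> (pprod (map (\<lambda>i. pcomm (y i) (z 1)) L)) = brs \<eta> (W L)" for L
  proof -
    have "set (map (\<lambda>i. pcomm (y i) (z 1)) L) \<subseteq> (FA :: 'k fpoly set)" by auto
    then show ?thesis by (simp add: hom_ext_pprod hom_ext_pcomm comp_def brs_W br_def)
  qed
  have cancel: "q * \<eta> (Z 1) ^ (2 * n) = 0" if "q * brs \<eta> (replicate (2 * n) (Z 1)) = 0" for q n
  proof -
    have "\<kappa> (2 ^ n) = 2 ^ n" using \<kappa>_of_nat[of "2 ^ n"] by simp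
    then have "\<kappa> (2 ^ n) * (q * \<eta> (Z 1) ^ (2 * n)) = q * brs \<eta> (replicate (2 * n) (Z 1))"
      unfolding \<kappa>_left_commute[of q, symmetric] by (simp only: brs_replicate_Z)
    with that have "\<kappa> (2 ^ n) * (q * \<eta> (Z 1) ^ (2 * n)) = \<kappa> (2 ^ n) * 0" by simp
    then show ?thesis using assms(3) by - (rule \<kappa>_cancel[of "2 ^ n"], auto)
  qed
  from assms(2) obtain k n where kn: "k \<ge> 1" "2 * n + 2 * k - 1 = p"
    and f: "f = pmul (pmul (pprod (map (\<lambda>i. pcomm (y i) (z 1)) [1..<2*k-1])) (pjor (z 2) (z 1))) (ppow (z 1) (2*n))
      \<or> f = pmul (pprod (map (\<lambda>i. pcomm (y i) (z 1)) [1..<2*k])) (ppow (z 1) (2*n))"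
    unfolding gens_p_def by blast
  have FA: "pprod (map (\<lambda>i. pcomm (y i) (z 1)) L) \<in> (FA :: 'k fpoly set)" for L
    by (rule pprod_FA) auto
  from f show ?thesis
  proof
    assume f: "f = pmul (pmul (pprod (map (\<lambda>i. pcomm (y i) (z 1)) [1..<2*k-1])) (pjor (z 2) (z 1))) (ppow (z 1) (2*n))"
    have "brs \<eta> ((W [1..<2*k-1] @ [Z 2, Z 1]) @ replicate (2 * n) (Z 1)) = 0"
      by (rule brs_eq_0_power[of _ 1]) (use len kn in \<open>auto simp: cnt[unfolded One_nat_def]\<close>)
    then have "brs \<eta> (W [1..<2*k-1]) * br \<eta> (Z 2) (Z 1) * brs \<eta> (replicate (2 * n) (Z 1)) = 0"
      using len by (simp add: brs_append_even mult.assoc)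
    from cancel[OF this] show ?thesis
      unfolding f by (simp add: hom_ext_pmul hom_ext_ppow hom_ext_pjor FA pprod br_def del: One_nat_def)
  next
    assume f: "f = pmul (pprod (map (\<lambda>i. pcomm (y i) (z 1)) [1..<2*k])) (ppow (z 1) (2*n))"
    have "brs \<eta> (W [1..<2*k] @ replicate (2 * n) (Z 1)) = 0"
      by (rule brs_eq_0_power[of _ 1]) (use len kn in \<open>auto simp: cnt[unfolded One_nat_def]\<close>)
    then have "brs \<eta> (W [1..<2*k]) * brs \<eta> (replicate (2 * n) (Z 1)) = 0"
      using len by (simp add: brs_append_even)
    from cancel[OF this] show ?thesis
      unfolding f by (simp add: hom_ext_pmul hom_ext_ppow FA pprod del: One_nat_def)
  qed
qed

end

section \<open>The identities hold in \<open>E \<otimes> E\<close>\<close>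

lemma mult_2_left_commute: "q * (2 * r) = 2 * (q * r :: 'r::ring_1)"
  by (simp add: mult_2 mult_2_right distrib_left)

locale colour =
  fixes g t :: "var \<Rightarrow> 'k::field ee"
  assumes g: "g v \<in> bihom False (isZ v)"
    and t: "t v \<in> bihom True (isZ v)"
begin

lemma tt: "t v * t w = (if isZ v \<and> isZ w then t w * t v else - (t w * t v))"
  using bihom_commute[OF t[of v] t[of w]] by auto

lemma gt: "g v * t w = (if isZ v \<and> isZ w then - (t w * g v) else t w * g v)"
  using bihom_commute[OF g[of v] t[of w]] by auto

lemma gg: "g v * g w = (if isZ v \<and> isZ w then - (g w * g v) else g w * g v)"
  using bihom_commute[OF g[of v] g[of w]] by auto

abbreviation x :: "var \<Rightarrow> 'k ee" where "x v \<equiv> g v + t v"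

text \<open>The sign in \<open>br\<close> cancels every product that contains some \<open>g\<close>.
  Odd left parity reverses the commutation sign of \<open>t v\<close> and \<open>t w\<close>, so
  these two products add up instead.\<close>

lemma br_eq: "br x v w = 2 * (t v * t w)"
  by (auto simp: br_def distrib_left distrib_right gt gg[of w v] tt[of w v] mult_2)

text \<open>\<open>t v * t w\<close> is even in the left factor, so only the right parities produce
  a sign, and it is the same for \<open>g u\<close> and \<open>t u\<close>.\<close>

lemma tt_x: "t v * t w * x u = (if isZ u \<and> isZ v \<noteq> isZ w then - (x u * (t v * t w)) else x u * (t v * t w))"
proof -
  have "t v * t w * t u = (if isZ u \<and> isZ v \<noteq> isZ w then - (t u * (t v * t w)) else t u * (t v * t w))"
    by (simp add: mult.assoc tt[of w u]) (simp add: tt[of v u] flip: mult.assoc)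
  moreover have "g u * (t v * t w) = (if isZ u \<and> isZ v \<noteq> isZ w then - (t v * t w * g u) else t v * t w * g u)"
    by (simp add: gt[of u v] mult.assoc[symmetric]) (simp add: gt[of u w] mult.assoc)
  ultimately show ?thesis by (auto simp: distrib_left distrib_right)
qed

sublocale bracket_relations x
proof
  show "br x v w * x u = (if isZ u \<and> isZ v \<noteq> isZ w then - (x u * br x v w) else x u * br x v w)" for v w u
    using tt_x[of v w u] by (simp add: br_eq mult_2_left_commute mult.assoc)
  show "br x a b * br x c d = (if isZ b \<and> isZ c then br x a c * br x b d else - (br x a c * br x b d))" for a b c d
  proof -
    have "t a * t b * (t c * t d) = (if isZ b \<and> isZ c then t a * t c * (t b * t d) else - (t a * t c * (t b * t d)))"
      using tt[of b c] by (auto simp: mult.assoc) (auto simp flip: mult.assoc)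
    moreover have "2 * q * (2 * r) = 4 * (q * r)" for q r :: "'k ee"
    proof -
      have "2 * q * (2 * r) = 2 * (2 * (q * r))" by (simp only: mult.assoc mult_2_left_commute[of q])
      then show ?thesis by (simp flip: mult.assoc)
    qed
    ultimately show ?thesis by (simp add: br_eq)
  qed
qed

end

section \<open>Powers of odd elements in characteristic \<open>p\<close>\<close>

text \<open>The binomial expansion stops after its linear term because \<open>d\<close> squares to
  0.\<close>

lemma square_zero_power:
  fixes u d :: "'r::ring_1"
  assumes "u * d = d * u" "d * d = 0"
  shows "(u + d) ^ Suc n = u ^ Suc n + of_nat (Suc n) * (u ^ n * d)"
proof (induction n)
  case (Suc n)
  have c: "r * (of_nat m * q) = of_nat m * (r * q)" for r q :: 'r and m
    by (simp only: mult.assoc[symmetric] mult_of_nat_commute[of m r])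
  have du: "d * u ^ k = u ^ k * d" for k
    using power_commuting_commutes[OF assms(1), of k] by simp
  have d0: "d * (u ^ k * d) = 0" for k
    by (simp only: du assms(2) mult_zero_right flip: mult.assoc) (simp only: mult.assoc assms(2) mult_zero_right)
  have "(u + d) ^ Suc (Suc n) = (u + d) * (u ^ Suc n + of_nat (Suc n) * (u ^ n * d))"
    using Suc by simp
  also have "\<dots> = u ^ Suc (Suc n) + of_nat (Suc n) * (u ^ Suc n * d) + d * u ^ Suc n"
    by (simp only: distrib_right distrib_left c d0 mult_zero_right power_Suc mult.assoc add_0_right add_0_left add_ac)
  also have "\<dots> = u ^ Suc (Suc n) + of_nat (Suc (Suc n)) * (u ^ Suc n * d)"
    unfolding du of_nat_Suc[of "Suc n"] distrib_right by (simp add: add_ac)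
  finally show ?case .
qed simp

lemma emon_square: "T \<noteq> {} \<Longrightarrow> emon S T c * emon S T d = 0"
proof (cases "finite S \<and> finite T")
  case False
  then have "emon S T d = 0" for d :: 'a
    by (intro ee_eqI) (auto simp: coeff_emon zero_ee.rep_eq)
  then show ?thesis by simp
qed (simp add: emon_times_emon)

text \<open>Elements that are odd in both factors commute, and their basis elements square to 0.
  Adding one such element changes the power only by a term with the factor \<open>CHAR('k)\<close>,
  which is 0.\<close>

lemma bihom_odd_power_CHAR:
  fixes u :: "'k::field ee"
  assumes "u \<in> bihom True True" "CHAR('k) > 0"
  shows "u ^ CHAR('k) = 0"
  using assms(1)
proof (induction u rule: bihom_induct)
  case zero
  then show ?case using assms(2) by (simp add: zero_power)
next
  case (add u S T c)
  obtain n where n: "CHAR('k) = Suc n" using assms(2) gr0_conv_Suc by blast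
  have m: "emon S T c \<in> bihom True True"
    using add by (auto simp: bihom_def coeff_emon)
  have "T \<noteq> {}" using add by auto
  then have "(u + emon S T c) ^ CHAR('k) = u ^ CHAR('k) + of_nat CHAR('k) * (u ^ n * emon S T c)"
    unfolding n by (intro square_zero_power emon_square) (use bihom_commute[OF add(1) m] in auto)
  moreover have "(of_nat CHAR('k) :: 'k ee) = 0"
    by (simp flip: ee.\<kappa>_of_nat)
  ultimately show ?case using add by simp
qed

lemma (in colour) bracket_relations_p:
  assumes "CHAR('k) > 2"
  shows "bracket_relations_p x CHAR('k)"
proof
  have "prime CHAR('k)" using assms by (intro prime_CHAR_semidom) auto
  then show "odd CHAR('k)" using assms prime_odd_nat by blast
  then obtain n where n: "CHAR('k) = 2 * n + 1" by (auto elim: oddE)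
  fix w i
  \<comment> \<open>The same string is computed from \<open>t\<close> here and from \<open>x\<close>
    in \<open>brs_replicate_Z\<close>. Cancelling \<open>2 ^ n\<close> shows that
    \<open>x (Z i)\<close> and \<open>t (Z i)\<close> have the same power of exponent
    \<open>p - 1\<close>.\<close>
  have "brs x (replicate (2 * n) (Z i)) = 2 ^ n * t (Z i) ^ (2 * n)"
  proof (induction n)
    case (Suc n)
    have "(t (Z i))\<^sup>2 * 2 ^ n = 2 ^ n * (t (Z i))\<^sup>2"
      using mult_of_nat_commute[of "2 ^ n" "(t (Z i))\<^sup>2"] by simp
    then have "2 * (t (Z i) * t (Z i)) * (2 ^ n * t (Z i) ^ (2 * n)) = 2 ^ Suc n * ((t (Z i))\<^sup>2 * t (Z i) ^ (2 * n))"
      by (simp add: power2_eq_square flip: mult.assoc) (simp add: mult.assoc)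
    with Suc show ?case by (simp add: br_eq power_add power2_eq_square mult.assoc)
  qed simp
  then have "2 ^ n * x (Z i) ^ (2 * n) = 2 ^ n * t (Z i) ^ (2 * n)"
    by (simp add: brs_replicate_Z)
  moreover have "(2 :: 'k ee) ^ n = scal_ee (2 ^ n)"
    using ee.\<kappa>_of_nat[of "2 ^ n", where 'k = 'k] by simp
  moreover have "(2 :: 'k) \<noteq> 0"
    using of_nat_eq_0_iff_char_dvd[of 2, where 'a = 'k] assms by (auto dest: dvd_imp_le)
  ultimately have "x (Z i) ^ (2 * n) = t (Z i) ^ (2 * n)"
    using ee.\<kappa>_cancel[of "2 ^ n"] by (metis power_not_zero)
  then have "br x w (Z i) * x (Z i) ^ (CHAR('k) - 1) = 2 * (t w * t (Z i) ^ CHAR('k))"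
    by (simp add: br_eq n mult.assoc)
  also have "t (Z i) ^ CHAR('k) = 0"
    using assms t[of "Z i"] by (intro bihom_odd_power_CHAR) auto
  finally show "br x w (Z i) * x (Z i) ^ (CHAR('k) - 1) = 0" by simp
qed

section \<open>Graded substitutions and the ideal of graded identities\<close>

definition ee_graded :: "(var \<Rightarrow> 'k::field ee) \<Rightarrow> bool" where
  "ee_graded \<eta> \<longleftrightarrow> (\<forall>v S T. coeff_ee (\<eta> v) (S, T) \<noteq> 0 \<longrightarrow> odd (card T) = isZ v)"

lemma ee_graded_iff: "ee_graded \<eta> \<longleftrightarrow> graded_subst (\<lambda>v. coeff_ee (\<eta> v))"
proof -
  have "(\<forall>v. P v) \<longleftrightarrow> (\<forall>i. P (Y i)) \<and> (\<forall>i. P (Z i))" for P by (metis var.exhaust)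
  note this[of "\<lambda>v. \<forall>S T. coeff_ee (\<eta> v) (S, T) \<noteq> 0 \<longrightarrow> odd (card T) = isZ v"]
  then show ?thesis
    unfolding ee_graded_def graded_subst_def AA0_def AA1_def by (simp add: coeff_ee)
qed

lemma ee_graded_colour:
  assumes "ee_graded \<eta>"
  obtains g t where "colour g t" "\<And>v. \<eta> v = g v + t v"
proof
  let ?g = "\<lambda>v. part (\<lambda>S T. even (card S)) (\<eta> v)" and ?t = "\<lambda>v. part (\<lambda>S T. odd (card S)) (\<eta> v)"
  show "colour ?g ?t"
    by standard (use assms in \<open>auto simp: bihom_def coeff_part ee_graded_def split: if_splits\<close>)
  show "\<eta> v = ?g v + ?t v" for v
    by (rule ee_eqI) (simp add: coeff_part plus_ee.rep_eq)
qed

lemma T2_A_iff: "f \<in> T2_A \<longleftrightarrow> f \<in> FA \<and> (\<forall>\<eta>. ee_graded \<eta> \<longrightarrow> ee.hom_ext \<eta> f = 0)"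
proof -
  have *: "aeval (\<lambda>v. coeff_ee (\<eta> v)) f = (\<lambda>st. 0) \<longleftrightarrow> ee.hom_ext \<eta> f = 0" for \<eta>
    by (simp add: aeval_eq_hom coeff_ee coeff_ee_inverse flip: coeff_ee_inject zero_ee.rep_eq)
  have "(\<forall>\<phi>. graded_subst \<phi> \<longrightarrow> aeval \<phi> f = (\<lambda>st. 0)) \<longleftrightarrow>
    (\<forall>\<eta>. ee_graded \<eta> \<longrightarrow> aeval (\<lambda>v. coeff_ee (\<eta> v)) f = (\<lambda>st. 0))"
  proof (intro iffI allI impI)
    fix \<phi> :: "var \<Rightarrow> 'a alg"
    assume H: "\<forall>\<eta>. ee_graded \<eta> \<longrightarrow> aeval (\<lambda>v. coeff_ee (\<eta> v)) f = (\<lambda>st. 0)" and \<phi>: "graded_subst \<phi>"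
    have "\<phi> v \<in> AA" for v using \<phi> by (cases v) (auto simp: graded_subst_def AA0_def AA1_def)
    then have "(\<lambda>v. coeff_ee (Abs_ee (\<phi> v))) = \<phi>" by (simp add: Abs_ee_inverse)
    with H \<phi> show "aeval \<phi> f = (\<lambda>st. 0)" by (metis ee_graded_iff)
  qed (auto simp: ee_graded_iff)
  then show ?thesis by (auto simp: T2_A_def *)
qed

lemma coeff_prod_list_ee_parity:
  assumes "ee_graded \<eta>" "coeff_ee (prod_list (map \<eta> w)) (S, T) \<noteq> 0"
  shows "odd (card T) = wdeg_odd w"
  using assms(2)
proof (induction w arbitrary: S T)
  case Nil
  then show ?case by (auto simp: one_ee.rep_eq aone_def wdeg_odd_def split: if_splits)
next
  case (Cons v w)
  then have "amul (coeff_ee (\<eta> v)) (coeff_ee (prod_list (map \<eta> w))) (S, T) \<noteq> 0"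
    by (simp add: times_ee.rep_eq)
  then show ?case
  proof (rule amul_supp)
    fix S1 T1 S2 T2
    assume *: "coeff_ee (\<eta> v) (S1, T1) \<noteq> 0" "coeff_ee (prod_list (map \<eta> w)) (S2, T2) \<noteq> 0"
      "T = T1 \<union> T2" "T1 \<inter> T2 = {}" "finite T"
    then have "odd (card T2) = wdeg_odd w" "odd (card T1) = isZ v"
      using Cons.IH assms(1) by (auto simp: ee_graded_def)
    moreover have "card T = card T1 + card T2" using * by (simp add: card_Un_disjoint)
    ultimately show ?thesis by (cases v) (auto simp: wdeg_odd_def)
  qed
qed

text \<open>A graded endomorphism followed by a graded substitution is again a graded substitution,
  because the value of a word has the right parity of the word.\<close>

lemma T2_A_T2_ideal: "is_T2_ideal (T2_A :: 'k::field fpoly set)"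
  unfolding is_T2_ideal_def
proof (intro conjI allI impI)
  show "is_ideal (T2_A :: 'k fpoly set)"
    unfolding is_ideal_def by (auto simp: T2_A_iff ee.hom_ext_simps)
  fix \<psi> :: "var \<Rightarrow> 'k fpoly" and f :: "'k fpoly"
  assume \<psi>: "graded_endo \<psi>" and f: "f \<in> T2_A"
  have FA: "\<psi> v \<in> FA" for v using \<psi> by (cases v) (auto simp: graded_endo_def FA0_def FA1_def)
  have deg: "wdeg_odd w = isZ v" if "\<psi> v w \<noteq> 0" for v w
    using \<psi> that by (cases v) (auto simp: graded_endo_def FA0_def FA1_def)
  let ?F = "Abs_fa f"
  have f': "f = coeff_fa ?F" using f by (simp add: T2_A_iff Abs_fa_inverse)
  have s: "psubst \<psi> f = coeff_fa (fa.hom (\<lambda>v. Abs_fa (\<psi> v)) ?F)"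
    by (simp add: psubst_eq_hom_ext FA fa.hom_def flip: f')
  have "ee.hom_ext \<eta> (psubst \<psi> f) = 0" if "ee_graded \<eta>" for \<eta> :: "var \<Rightarrow> 'k ee"
  proof -
    let ?\<eta> = "\<lambda>v. ee.hom \<eta> (Abs_fa (\<psi> v))"
    have "odd (card T) = isZ v" if nz: "coeff_ee (?\<eta> v) (S, T) \<noteq> 0" for v S T
    proof -
      from nz obtain w where "\<psi> v w \<noteq> 0" "coeff_ee (prod_list (map \<eta> w)) (S, T) \<noteq> 0"
        by (auto simp: ee.hom_def ee.hom_ext_def Abs_fa_inverse FA coeff_sum_ee coeff_scal_ee_times
            elim!: sum.not_neutral_contains_not_neutral)
      with coeff_prod_list_ee_parity[OF \<open>ee_graded \<eta>\<close>] deg show ?thesis by metis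
    qed
    then have "ee_graded ?\<eta>" by (simp add: ee_graded_def)
    then have "ee.hom_ext ?\<eta> f = 0" using f by (simp add: T2_A_iff)
    moreover have "ee.hom_ext \<eta> (psubst \<psi> f) = ee.hom_ext ?\<eta> f"
      using ee.hom_hom[of \<eta> "\<lambda>v. Abs_fa (\<psi> v)" ?F] by (simp add: s ee.hom_def flip: f')
    ultimately show ?thesis by simp
  qed
  moreover have "psubst \<psi> f \<in> FA" by (simp add: s coeff_fa)
  ultimately show "psubst \<psi> f \<in> T2_A" by (simp add: T2_A_iff)
qed

lemma gens_I_FA: "gens_I \<subseteq> FA"
  unfolding gens_I_def by auto

lemma gens_p_FA: "gens_p p \<subseteq> FA"
proof -
  have "pprod (map (\<lambda>i. pcomm (y i) (z 1)) L) \<in> (FA :: 'a fpoly set)" for L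
    by (rule pprod_FA) auto
  then show ?thesis unfolding gens_p_def by auto
qed

lemma gens_I_T2_A: "gens_I \<subseteq> T2_A"
proof
  fix f :: "'k::field fpoly" assume f: "f \<in> gens_I"
  have "ee.hom_ext \<eta> f = 0" if "ee_graded \<eta>" for \<eta> :: "var \<Rightarrow> 'k ee"
  proof -
    from that obtain g t where "colour g t" and \<eta>: "\<And>v. \<eta> v = g v + t v" by (rule ee_graded_colour) blast
    then interpret colour g t by simp
    have "\<eta> = x" using \<eta> by auto
    then show ?thesis using ee.gens_I_vanish[OF bracket_relations_axioms f] by simp
  qed
  then show "f \<in> T2_A" using f gens_I_FA by (auto simp: T2_A_iff)
qed

lemma gens_p_T2_A:
  assumes "CHAR('k) > 2"
  shows "gens_p CHAR('k) \<subseteq> (T2_A :: 'k::field fpoly set)"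
proof
  fix f :: "'k fpoly" assume f: "f \<in> gens_p CHAR('k)"
  have two: "(2 :: 'k) \<noteq> 0"
    using of_nat_eq_0_iff_char_dvd[of 2, where 'a = 'k] assms by (auto dest: dvd_imp_le)
  have "ee.hom_ext \<eta> f = 0" if "ee_graded \<eta>" for \<eta> :: "var \<Rightarrow> 'k ee"
  proof -
    from that obtain g t where "colour g t" and \<eta>: "\<And>v. \<eta> v = g v + t v" by (rule ee_graded_colour) blast
    then interpret colour g t by simp
    have "\<eta> = x" using \<eta> by auto
    then show ?thesis using ee.gens_p_vanish[OF bracket_relations_p[OF assms] f two] by simp
  qed
  then show "f \<in> T2_A" using f gens_p_FA by (auto simp: T2_A_iff)
qed

section \<open>Spanning by normal forms\<close>

text \<open>An arbitrary fixed order: a different one affects a normal form only by signs and by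
  terms with shorter words.\<close>

definition lst :: "'a multiset \<Rightarrow> 'a list" where "lst M = (SOME xs. mset xs = M)"

lemma mset_lst [simp]: "mset (lst M) = M"
  unfolding lst_def by (rule someI_ex) (rule ex_mset)

lemma length_lst [simp]: "length (lst M) = size M"
  by (metis mset_lst size_mset)

text \<open>\<open>p = 0\<close> stands for characteristic zero.\<close>
definition normal :: "nat \<Rightarrow> (var multiset \<times> var multiset) set" where
  "normal p = {(X, T). (\<forall>i. count X (Z i) \<le> 1) \<and> (\<forall>i. count T (Y i) \<le> 1) \<and>
     (\<forall>i. 0 < p \<longrightarrow> count T (Z i) < p) \<and> even (size T)}"

definition nf :: "(var \<Rightarrow> 'r::ring_1) \<Rightarrow> var multiset \<times> var multiset \<Rightarrow> 'r" where
  "nf x = (\<lambda>(X, T). prod_list (map x (lst X)) * brs x (lst T))"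

lemma (in scalars) hom_nf: "hom \<eta> (nf var_fa m) = nf \<eta> m"
proof -
  have "hom \<eta> (brs var_fa ts) = brs \<eta> ts" for ts
    by (induction "var_fa :: var \<Rightarrow> 'k fa" ts rule: brs.induct) (auto simp: br_def)
  then show ?thesis by (cases m) (simp add: nf_def hom_prod_list comp_def)
qed

locale spanning = scalars \<kappa> + bracket_relations x
  for \<kappa> :: "'k::field \<Rightarrow> 'r::ring_1" and x :: "var \<Rightarrow> 'r" +
  fixes p :: nat
  assumes two: "(2 :: 'k) \<noteq> 0"
    and brs_power: "0 < p \<Longrightarrow> p \<le> count (mset ts) (Z i) \<Longrightarrow> even (length ts) \<Longrightarrow> brs x ts = 0"
begin

abbreviation N where "N \<equiv> span (nf x ` normal p)"

text \<open>Induction on the length of the word, for all even strings at once, since each correction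
  term moves two letters from the word into the string.\<close>

lemma monomial_in_span:
  assumes "even (length ts)"
  shows "prod_list (map x xs) * brs x ts \<in> N"
  using assms
proof (induction "length xs" arbitrary: xs ts rule: less_induct)
  case less
  let ?P = "\<lambda>xs. prod_list (map x xs) * brs x ts \<in> N"
  \<comment> \<open>A bracket inside the word passes the letters to its right at the cost of a sign
    and joins the string. The remaining word is shorter, so the induction hypothesis
    applies.\<close>
  have br: "prod_list (map x as) * br x v w * prod_list (map x bs) * brs x ts \<in> N"
    if "length as + length bs < length xs" for as bs v w
  proof -
    obtain s where s: "s \<in> {1, - 1}" "br x v w * prod_list (map x bs) = s * (prod_list (map x bs) * br x v w)"
      using br_prod by blast
    have "prod_list (map x as) * br x v w * prod_list (map x bs) * brs x ts
        = s * (prod_list (map x (as @ bs)) * brs x (v # w # ts))"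
      using s by (auto simp: mult.assoc)
    moreover have "prod_list (map x (as @ bs)) * brs x (v # w # ts) \<in> N"
      using less.prems that by (intro less.hyps) auto
    ultimately show ?thesis using s(1) by (auto simp: span_neg)
  qed
  have perm: "length ys = length xs \<longrightarrow> (?P ys \<longleftrightarrow> ?P zs)" if "mset ys = mset zs" for ys zs
  proof -
    \<comment> \<open>Repeating the length condition in the conclusion makes the relation
      transitive, as the induction over swaps requires.\<close>
    have "length ys = length xs \<longrightarrow> length zs = length xs \<and> (?P ys \<longleftrightarrow> ?P zs)"
    proof (rule mset_eq_induct_swap[OF _ _ _ that], goal_cases)
      case (3 as v w bs)
      show ?case
      proof
        assume len: "length (as @ v # w # bs) = length xs"
        let ?q = "\<lambda>v w. prod_list (map x (as @ v # w # bs)) * brs x ts"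
        define b where "b = prod_list (map x as) * br x v w * prod_list (map x bs) * brs x ts"
        have "b \<in> N" unfolding b_def using len by (intro br) auto
        moreover have "?q v w = b - ?q w v \<or> ?q v w = b + ?q w v"
          by (auto simp: b_def br_def distrib_left distrib_right left_diff_distrib right_diff_distrib mult.assoc)
        ultimately have "?q v w \<in> N \<longleftrightarrow> ?q w v \<in> N"
          using span_add_eq[of b _ "?q w v"] span_add_eq[of b _ "- ?q w v"] span_neg[of "?q w v"]
            span_neg[of "- ?q w v"] by auto
        then show "length (as @ w # v # bs) = length xs \<and> (?q v w \<in> N \<longleftrightarrow> ?q w v \<in> N)"
          using len by simp
      qed
    qed auto
    then show ?thesis by blast
  qed
  show ?case
  proof (cases "\<exists>i. count (mset xs) (Z i) > 1")
    case True
    then obtain i where "1 < count (mset xs) (Z i)" by blast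
    then have "2 \<le> count (mset xs) (Z i)" by simp
    then have "{#Z i, Z i#} \<subseteq># mset xs"
      by (metis count_le_replicate_mset_subset_eq numeral_2_eq_2 replicate_mset_0 replicate_mset_Suc)
    then obtain M where "mset xs = {#Z i, Z i#} + M" by (metis subset_mset.le_iff_add)
    moreover obtain ms where "M = mset ms" by (metis ex_mset)
    ultimately have ms: "mset xs = mset (Z i # Z i # ms)" by simp
    then have len: "length xs = Suc (Suc (length ms))" by (metis length_Cons size_mset)
    let ?q = "x (Z i) * x (Z i) * prod_list (map x ms) * brs x ts"
    have "prod_list (map x []) * br x (Z i) (Z i) * prod_list (map x ms) * brs x ts \<in> N"
      by (rule br) (use len in auto)
    also have "prod_list (map x []) * br x (Z i) (Z i) * prod_list (map x ms) * brs x ts = \<kappa> 2 * ?q"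
      using \<kappa>_of_nat[of 2] by (simp add: br_ZZ power2_eq_square mult.assoc)
    finally have "\<kappa> (inverse 2) * (\<kappa> 2 * ?q) \<in> N" by (rule span_scale)
    then have "?q \<in> N" using two by (simp flip: mult.assoc \<kappa>_mult)
    then show ?thesis using perm[OF ms] by (simp add: mult.assoc)
  next
    case X: False
    show ?thesis
    proof (cases "(\<exists>i. count (mset ts) (Y i) > 1) \<or> (\<exists>i. 0 < p \<and> count (mset ts) (Z i) \<ge> p)")
      case True
      then have "brs x ts = 0"
        using brs_eq_0_repeat_Y brs_power less.prems by (metis Suc_1 Suc_leI)
      then show ?thesis by (simp add: span_zero)
    next
      case False
      then have "(mset xs, mset ts) \<in> normal p"
        using X less.prems by (auto simp: normal_def not_less not_le)
      then have "nf x (mset xs, mset ts) \<in> N" by (intro span_base imageI)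
      moreover have "brs x (lst (mset ts)) \<in> {brs x ts, - brs x ts}"
        by (rule brs_mset) simp
      ultimately have "?P (lst (mset xs))"
        using span_neg[of "nf x (mset xs, mset ts)"] by (auto simp: nf_def)
      then show ?thesis using perm[of xs "lst (mset xs)"] by simp
    qed
  qed
qed

lemma hom_in_span: "hom x f \<in> N"
proof -
  have "prod_list (map x w) \<in> N" for w using monomial_in_span[of "[]" w] by simp
  then show ?thesis unfolding hom_def hom_ext_def by (intro span_sum span_scale)
qed

end

section \<open>The bracket relations as consequences of (1)-(7)\<close>

text \<open>An algebra in which (1)-(7) hold for all values in an even part \<open>R0\<close> and an
  odd part \<open>R1\<close>. \<open>R01\<close> admits products \<open>y z\<close> as values of odd
  variables, the one composite substitution that occurs.\<close>

locale graded_identities = scalars \<kappa> for \<kappa> :: "'k::field \<Rightarrow> 'r::ring_1" +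
  fixes R0 R1 :: "'r set" and x :: "var \<Rightarrow> 'r"
  assumes vanish: "(\<And>i. \<eta> (Y i) \<in> R0) \<Longrightarrow> (\<And>i. \<eta> (Z i) \<in> R1) \<Longrightarrow> f \<in> gens_I \<Longrightarrow> hom_ext \<eta> f = 0"
    and xY [simp]: "x (Y i) \<in> R0" and xZ [simp]: "x (Z i) \<in> R1"
    and R01: "a \<in> R0 \<Longrightarrow> c \<in> R1 \<Longrightarrow> a * c \<in> R1"
begin

abbreviation comm :: "'r \<Rightarrow> 'r \<Rightarrow> 'r" where "comm a b \<equiv> a * b - b * a"
abbreviation jor :: "'r \<Rightarrow> 'r \<Rightarrow> 'r" where "jor a b \<equiv> a * b + b * a"

text \<open>The variables of the generators are numbered from 1, so entry 0 of each list is padding,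
  as are the entries of indices that the identity skips. Beyond the lists, \<open>x v\<close>
  supplies a value of the correct degree.\<close>

definition val :: "'r list \<Rightarrow> 'r list \<Rightarrow> var \<Rightarrow> 'r" where
  "val as cs v = (case v of Y i \<Rightarrow> if i < length as then as ! i else x v
     | Z i \<Rightarrow> if i < length cs then cs ! i else x v)"

lemma vanish_val:
  assumes "set as \<subseteq> R0" "set cs \<subseteq> R1" "f \<in> gens_I"
  shows "hom_ext (val as cs) f = 0"
  by (rule vanish) (use assms in \<open>auto simp: val_def\<close>)

lemma comm_YY_Y:
  assumes "a \<in> R0" "b \<in> R0" "c \<in> R0"
  shows "comm a b * c = c * comm a b"
  using vanish_val[of "[a, a, b, c]" "[]" "pcomm (pcomm (y 1) (y 2)) (y 3)"] assms
  by (simp add: gens_I_def hom_ext_pcomm val_def)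

lemma comm_YY_Z:
  assumes "a \<in> R0" "b \<in> R0" "c \<in> R1"
  shows "comm a b * c = c * comm a b"
  using vanish_val[of "[a, a, b]" "[c, c, c, c]" "pcomm (pcomm (y 1) (y 2)) (z 3)"] assms
  by (simp add: gens_I_def hom_ext_pcomm val_def)

lemma comm_YZ_Y:
  assumes "a \<in> R0" "b \<in> R1" "c \<in> R0"
  shows "comm a b * c = c * comm a b"
  using vanish_val[of "[a, a, c, c]" "[b, b, b]" "pcomm (pcomm (y 1) (z 2)) (y 3)"] assms
  by (simp add: gens_I_def hom_ext_pcomm val_def)

lemma comm_YZ_Z:
  assumes "a \<in> R0" "b \<in> R1" "c \<in> R1"
  shows "comm a b * c = - (c * comm a b)"
  using vanish_val[of "[a, a]" "[b, b, b, c]" "pjor (pcomm (y 1) (z 2)) (z 3)"] assms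
  by (simp add: gens_I_def hom_ext_pcomm hom_ext_pjor val_def eq_neg_iff_add_eq_0)

lemma jor_Z:
  assumes "a \<in> R1" "b \<in> R1" "c \<in> R1"
  shows "jor a b * c = c * jor a b"
  using vanish_val[of "[]" "[a, a, b, c]" "pcomm (pjor (z 1) (z 2)) (z 3)"] assms
  by (simp add: gens_I_def hom_ext_pcomm hom_ext_pjor val_def)

lemma jor_jor:
  assumes "a \<in> R1" "b \<in> R1" "c \<in> R1" "d \<in> R1"
  shows "jor a b * jor c d = jor a c * jor b d"
  using vanish_val[of "[]" "[a, a, b, c, d]"
      "psub (pmul (pjor (z 1) (z 2)) (pjor (z 3) (z 4))) (pmul (pjor (z 1) (z 3)) (pjor (z 2) (z 4)))"] assms
  by (simp add: gens_I_def hom_ext_psub hom_ext_pmul hom_ext_pjor val_def)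

lemma comm_jor:
  assumes "a \<in> R0" "b \<in> R1" "c \<in> R1" "d \<in> R1"
  shows "comm a b * jor c d = comm a c * jor b d"
  using vanish_val[of "[a, a]" "[b, b, b, c, d]"
      "psub (pmul (pcomm (y 1) (z 2)) (pjor (z 3) (z 4))) (pmul (pcomm (y 1) (z 3)) (pjor (z 2) (z 4)))"] assms
  by (simp add: gens_I_def hom_ext_psub hom_ext_pmul hom_ext_pcomm hom_ext_pjor val_def)

lemma comm_comm:
  assumes "b \<in> R0" "c \<in> R0" "a \<in> R0 \<union> R1" "d \<in> R0 \<union> R1"
  shows "comm a b * comm c d = - (comm a c * comm b d)"
proof -
  \<comment> \<open>One graded substitution serves all four forms of (6): in whichever parity
    \<open>a\<close> or \<open>d\<close> does not have, a variable of that parity takes its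
    place.\<close>
  let ?a0 = "if a \<in> R0 then a else x (Y 0)" and ?a1 = "if a \<in> R1 then a else x (Z 0)"
  let ?d0 = "if d \<in> R0 then d else x (Y 0)" and ?d1 = "if d \<in> R1 then d else x (Z 0)"
  let ?f = "\<lambda>x1 x4. padd (pmul (pcomm x1 (y 2)) (pcomm (y 3) x4)) (pmul (pcomm x1 (y 3)) (pcomm (y 2) x4)) :: 'k fpoly"
  let ?\<eta> = "val [b, ?a0, b, c, ?d0] [?a1, ?a1, ?a1, ?a1, ?d1]"
  have v: "hom_ext ?\<eta> (?f x1 x4) = 0" if "x1 \<in> {y 1, z 1}" "x4 \<in> {y 4, z 4}" for x1 x4
    by (rule vanish_val) (use assms that in \<open>auto simp: gens_I_def\<close>)
  show ?thesis
    using assms(3,4) v[of "y 1" "y 4"] v[of "y 1" "z 4"] v[of "z 1" "y 4"] v[of "z 1" "z 4"]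
    by (auto simp: hom_ext_padd hom_ext_pmul hom_ext_pcomm val_def eq_neg_iff_add_eq_0)
qed

text \<open>The commutator with \<open>c\<close> is a derivation, and both terms it produces from
  \<open>jor a b\<close> vanish by (3).\<close>

lemma jor_Y:
  assumes "a \<in> R1" "b \<in> R1" "c \<in> R0"
  shows "jor a b * c = c * jor a b"
proof -
  have "c * jor a b - jor a b * c = (comm c a * b + b * comm c a) + (comm c b * a + a * comm c b)"
    by (simp add: algebra_simps)
  also have "\<dots> = 0" using comm_YZ_Z[OF assms(3,1,2)] comm_YZ_Z[OF assms(3,2,1)] by simp
  finally show ?thesis by simp
qed

text \<open>This is identity (3) at \<open>a\<close>, \<open>b c\<close>, \<open>d\<close>.\<close>

lemma comm_YY_jor:
  assumes "a \<in> R0" "b \<in> R0" "c \<in> R1" "d \<in> R1"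
  shows "comm a b * jor c d = comm b d * comm a c"
proof -
  have "comm a (b * c) * d + d * comm a (b * c) = 0"
    using comm_YZ_Z[OF assms(1) R01[OF assms(2,3)] assms(4)] by simp
  moreover have "comm a (b * c) * d + d * comm a (b * c) =
      comm a b * jor c d - comm b d * comm a c + (d * comm a b - comm a b * d) * c
      + b * (comm a c * d + d * comm a c)"
    by (simp add: algebra_simps)
  moreover have "d * comm a b - comm a b * d = 0"
    using comm_YY_Z[OF assms(1,2,4)] by simp
  moreover have "comm a c * d + d * comm a c = 0"
    using comm_YZ_Z[OF assms(1,3,4)] by simp
  ultimately show ?thesis by simp
qed

lemma br_YY': "br x (Y i) (Y j) = comm (x (Y i)) (x (Y j))"
  and br_YZ': "br x (Y i) (Z j) = comm (x (Y i)) (x (Z j))"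
  and br_ZY': "br x (Z i) (Y j) = comm (x (Z i)) (x (Y j))"
  and br_ZZ': "br x (Z i) (Z j) = jor (x (Z i)) (x (Z j))"
  by (simp_all add: br_def)

lemmas br_cases = br_YY' br_YZ' br_ZY' br_ZZ'

lemma br_x_Y: "br x (Y i) w * x u = (if isZ u \<and> isZ w then - (x u * br x (Y i) w) else x u * br x (Y i) w)"
  by (cases w; cases u) (simp_all only: br_cases isZ_simps simp_thms if_True if_False
      comm_YY_Y[OF xY xY xY] comm_YY_Z[OF xY xY xZ] comm_YZ_Y[OF xY xZ xY] comm_YZ_Z[OF xY xZ xZ])

lemma br_x_graded:
  "br x v w * x u = (if isZ u \<and> isZ v \<noteq> isZ w then - (x u * br x v w) else x u * br x v w)"
proof (cases v)
  case (Y i)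
  then show ?thesis using br_x_Y[of i w u] by simp
next
  case v: (Z i)
  show ?thesis
  proof (cases w)
    case (Y j)
    then show ?thesis using br_x_Y[of j v u] br_sym[of x v w] v by auto
  next
    case (Z j)
    then show ?thesis using v
      by (cases u) (simp_all only: br_cases isZ_simps simp_thms if_True if_False
          jor_Y[OF xZ xZ xY] jor_Z[OF xZ xZ xZ])
  qed
qed

text \<open>Moving a bracket past the two letters of another one. Reversing two brackets in this way
  turns an exchange of outer entries into an exchange of inner ones.\<close>

lemma br_comm:
  "br x a b * br x c d = (if isZ a \<noteq> isZ b \<and> isZ c \<noteq> isZ d then - (br x c d * br x a b) else br x c d * br x a b)"
proof -
  have "br x a b * (x v * x w) = (if isZ a \<noteq> isZ b \<and> isZ v \<noteq> isZ w then - (x v * x w * br x a b) else x v * x w * br x a b)" for v w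
    by (simp add: br_x_graded[of a b v] mult.assoc[symmetric]) (simp add: br_x_graded[of a b w] mult.assoc)
  from this[of c d] this[of d c] show ?thesis
    by (auto simp: br_def[of x c d] distrib_left distrib_right left_diff_distrib right_diff_distrib)
qed

lemma br_br_YY: "br x a (Y i) * br x (Y j) d = - (br x a (Y j) * br x (Y i) d)"
proof -
  have "br x v (Y i) = comm (x v) (x (Y i))" "br x (Y i) v = comm (x (Y i)) (x v)" for v i
    by (auto simp: br_def)
  moreover have "x v \<in> R0 \<union> R1" for v by (cases v) auto
  ultimately show ?thesis using comm_comm[of "x (Y i)" "x (Y j)" "x a" "x d"] by simp
qed

lemma br_br_ZZZ: "br x a (Z i) * br x (Z j) (Z k) = br x a (Z j) * br x (Z i) (Z k)"
  by (cases a) (simp_all only: br_cases jor_jor[OF xZ xZ xZ xZ, of _ i j k] comm_jor[OF xY xZ xZ xZ, of _ i j k])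

text \<open>For even \<open>a\<close> and \<open>d\<close>, reversing the brackets puts these two
  inside, where (6) exchanges them; turning the results around gives the exchange of the odd
  entries. In the other cases (5) and (7) suffice.\<close>

lemma br_br_ZZ: "br x a (Z i) * br x (Z j) d = br x a (Z j) * br x (Z i) d"
proof (cases d)
  case d: (Y k)
  show ?thesis
  proof (cases a)
    case (Y l)
    then show ?thesis
      using br_br_YY[of "Z j" k l "Z i"] br_comm[of a "Z i" "Z j" d] br_sym[of x a "Z j"] br_sym[of x d "Z i"] d
      by simp
  next
    case (Z l)
    then show ?thesis
      using br_br_ZZZ[of d j i l] br_comm[of a "Z i" "Z j" d] br_comm[of a "Z j" "Z i" d] br_sym[of x d "Z j"] br_sym[of x d "Z i"]
        br_sym[of x a "Z i"] br_sym[of x a "Z j"] d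
      by simp
  qed
qed (simp add: br_br_ZZZ)

text \<open>For even \<open>a\<close> this is the pattern that rests on the substituted form of (3);
  for odd \<open>a\<close> two applications of (7) give it.\<close>

lemma br_br_YZZ: "br x a (Y i) * br x (Z j) (Z k) = - (br x a (Z j) * br x (Y i) (Z k))"
proof (cases a)
  case (Y l)
  then show ?thesis
    using comm_YY_jor[OF xY xY xZ xZ, of l i j k] br_comm[of a "Z j" "Y i" "Z k"] by (simp add: br_cases)
next
  case (Z l)
  then show ?thesis
    using br_br_ZZZ[of "Y i" l j k] br_br_ZZZ[of "Y i" k j l] br_comm[of a "Z j" "Y i" "Z k"]
      br_sym[of x a "Y i"] br_sym[of x "Z k" a] br_sym[of x "Z j" a] by simp
qed

text \<open>If \<open>d\<close> is even, turning the brackets around leads to (6) for even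
  \<open>a\<close> and to the preceding pattern for odd \<open>a\<close>.\<close>

lemma br_br_YZ: "br x a (Y i) * br x (Z j) d = - (br x a (Z j) * br x (Y i) d)"
proof (cases d)
  case d: (Y k)
  show ?thesis
  proof (cases a)
    case (Y l)
    then show ?thesis
      using br_br_YY[of "Y i" l k "Z j"] br_comm[of a "Z j" "Y i" d] br_sym[of x a "Y i"] br_sym[of x d "Z j"] d
      by simp
  next
    case (Z l)
    then show ?thesis
      using br_br_YZZ[of "Y i" k l j] br_comm[of a "Z j" "Y i" d] br_comm[of a "Y i" "Z j" d]
        br_comm[of "Y i" "Z l" "Y k" "Z j"]
        br_sym[of x a "Y i"] br_sym[of x d "Z j"] d
      by simp
  qed
qed (simp add: br_br_YZZ)

lemma bracket_relations: "bracket_relations x"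
proof
  show "br x v w * x u = (if isZ u \<and> isZ v \<noteq> isZ w then - (x u * br x v w) else x u * br x v w)" for v w u
    by (rule br_x_graded)
  show "br x a b * br x c d = (if isZ b \<and> isZ c then br x a c * br x b d else - (br x a c * br x b d))" for a b c d
  proof (cases b; cases c)
    fix i j assume "b = Y i" "c = Y j"
    then show ?thesis using br_br_YY[of a i j d] by simp
  next
    fix i j assume "b = Y i" "c = Z j"
    then show ?thesis using br_br_YZ[of a i j d] by simp
  next
    fix i j assume "b = Z i" "c = Y j"
    then show ?thesis using br_br_YZ[of a j i d] by simp
  next
    fix i j assume "b = Z i" "c = Z j"
    then show ?thesis using br_br_ZZ[of a i j d] by simp
  qed
qed

end

section \<open>The relatively free algebra\<close>

text \<open>\<open>T2_A\<close> is one of the intersected ideals, so the intersection is not over an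
  empty family and stays inside \<open>FA\<close>.\<close>

lemma T2_gen_T2_ideal:
  assumes "G \<subseteq> T2_A"
  shows "is_T2_ideal (T2_gen G)"
proof -
  have "T2_gen G \<subseteq> FA"
    using assms T2_A_T2_ideal unfolding T2_gen_def by (auto simp: T2_A_iff)
  then show ?thesis
    unfolding T2_gen_def is_T2_ideal_def is_ideal_def by auto
qed

lemma T2_gen_subset_T2_A: "G \<subseteq> T2_A \<Longrightarrow> T2_gen G \<subseteq> T2_A"
  using T2_A_T2_ideal by (auto simp: T2_gen_def)

lemma subset_T2_gen: "G \<subseteq> T2_gen G"
  by (auto simp: T2_gen_def)

text \<open>One generating set for both characteristics, so that the quotient is constructed only
  once.\<close>

definition gens :: "'k::field fpoly set" where
  "gens = gens_I \<union> (if CHAR('k) > 2 then gens_p CHAR('k) else {})"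

lemma gens_T2_A: "gens \<subseteq> (T2_A :: 'k::field fpoly set)"
  using gens_I_T2_A gens_p_T2_A[where 'k = 'k] by (auto simp: gens_def)

definition JJ :: "'k::field fa set" where "JJ = {f. coeff_fa f \<in> T2_gen gens}"

lemma JJ_ideal:
  shows JJ_0: "0 \<in> (JJ :: 'k::field fa set)"
    and JJ_add: "f \<in> JJ \<Longrightarrow> g \<in> JJ \<Longrightarrow> f + g \<in> (JJ :: 'k fa set)"
    and JJ_mult: "f \<in> JJ \<Longrightarrow> h * f \<in> (JJ :: 'k fa set)" "f \<in> JJ \<Longrightarrow> f * h \<in> (JJ :: 'k fa set)"
  using T2_gen_T2_ideal[OF gens_T2_A[where 'k = 'k]]
  by (auto simp: JJ_def is_T2_ideal_def is_ideal_def zero_fa.rep_eq plus_fa.rep_eq times_fa.rep_eq coeff_fa)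

lemma JJ_uminus: "f \<in> JJ \<Longrightarrow> - f \<in> JJ"
  using JJ_mult(1)[of f "- 1"] by simp

lemma JJ_diff: "f \<in> JJ \<Longrightarrow> g \<in> JJ \<Longrightarrow> f - g \<in> JJ"
  using JJ_add[of f "- g"] JJ_uminus[of g] by simp

quotient_type (overloaded) 'k rf = "'k::field fa" / "\<lambda>f g. f - g \<in> JJ" morphisms rep_rf cls
proof (rule equivpI)
  show "reflp (\<lambda>f g :: 'k fa. f - g \<in> JJ)" by (simp add: reflp_def JJ_0)
  show "symp (\<lambda>f g :: 'k fa. f - g \<in> JJ)"
    by (rule sympI) (metis JJ_uminus minus_diff_eq)
  show "transp (\<lambda>f g :: 'k fa. f - g \<in> JJ)"
    by (rule transpI) (metis JJ_add diff_add_cancel add_diff_eq)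
qed

lemma cls_eq_iff: "cls f = cls g \<longleftrightarrow> f - g \<in> JJ"
  by (rule rf.abs_eq_iff)

instantiation rf :: (field) ring_1
begin
lift_definition zero_rf :: "'a rf" is 0 .
lift_definition one_rf :: "'a rf" is 1 .
lift_definition plus_rf :: "'a rf \<Rightarrow> 'a rf \<Rightarrow> 'a rf" is "(+)"
  by (metis JJ_add add_diff_add)
lift_definition minus_rf :: "'a rf \<Rightarrow> 'a rf \<Rightarrow> 'a rf" is "(-)"
proof -
  fix a b c d :: "'a fa" assume "a - b \<in> JJ" "c - d \<in> JJ"
  then have "(a - b) - (c - d) \<in> JJ" by (rule JJ_diff)
  then show "a - c - (b - d) \<in> JJ" by (simp add: algebra_simps)
qed
lift_definition uminus_rf :: "'a rf \<Rightarrow> 'a rf" is uminus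
proof -
  fix a b :: "'a fa" assume "a - b \<in> JJ"
  then have "- (a - b) \<in> JJ" by (rule JJ_uminus)
  then show "- a - - b \<in> JJ" by simp
qed
lift_definition times_rf :: "'a rf \<Rightarrow> 'a rf \<Rightarrow> 'a rf" is "(*)"
proof -
  fix a b c d :: "'a fa" assume "a - b \<in> JJ" "c - d \<in> JJ"
  then have "(a - b) * c + b * (c - d) \<in> JJ" by (intro JJ_add JJ_mult)
  then show "a * c - b * d \<in> JJ" by (simp add: algebra_simps)
qed
instance
proof
  fix a b c :: "'a rf"
  show "a * b * c = a * (b * c)" by transfer (simp add: mult.assoc JJ_0)
  show "1 * a = a" by transfer (simp add: JJ_0)
  show "a * 1 = a" by transfer (simp add: JJ_0)
  show "a + b + c = a + (b + c)" by transfer (simp add: add.assoc JJ_0)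
  show "a + b = b + a" by transfer (simp add: add.commute JJ_0)
  show "0 + a = a" by transfer (simp add: JJ_0)
  show "- a + a = 0" by transfer (simp add: JJ_0)
  show "a - b = a + - b" by transfer (simp add: JJ_0)
  show "(a + b) * c = a * c + b * c" by transfer (simp add: distrib_right JJ_0)
  show "a * (b + c) = a * b + a * c" by transfer (simp add: distrib_left JJ_0)
  \<comment> \<open>The quotient is not the zero ring: elements of the ideal are identities of
    \<open>E \<otimes> E\<close>, but 1 keeps the value 1 at the zero substitution.\<close>
  have "1 \<notin> (JJ :: 'a fa set)"
  proof
    assume "1 \<in> (JJ :: 'a fa set)"
    then have "(pone :: 'a fpoly) \<in> T2_A"
      using T2_gen_subset_T2_A[OF gens_T2_A] by (auto simp: JJ_def one_fa.rep_eq)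
    then have "\<forall>\<eta> :: var \<Rightarrow> 'a ee. \<not> ee_graded \<eta>" by (simp add: T2_A_iff)
    moreover have "ee_graded (\<lambda>_. 0 :: 'a ee)" by (simp add: ee_graded_def zero_ee.rep_eq)
    ultimately show False by blast
  qed
  then have "- 1 \<notin> (JJ :: 'a fa set)" using JJ_uminus[of "- 1"] by auto
  then show "(0 :: 'a rf) \<noteq> 1" by transfer simp
qed
end

lemma cls_simps:
  "cls (f + g) = cls f + cls g" "cls (f * g) = cls f * cls g" "cls (f - g) = cls f - cls g"
  "cls 0 = 0" "cls 1 = 1"
  by (simp_all add: plus_rf.abs_eq times_rf.abs_eq minus_rf.abs_eq zero_rf_def one_rf_def)

lemma cls_eq_0: "cls f = 0 \<longleftrightarrow> f \<in> JJ"
  using cls_eq_iff[of f 0] by (simp add: cls_simps)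

lemma cls_surj: "\<exists>f. cls f = q"
  by (metis Quotient3_abs_rep Quotient3_rf)

definition scal_rf :: "'k::field \<Rightarrow> 'k rf" where "scal_rf c = cls (scal_fa c)"

interpretation rf: scalars "scal_rf :: 'k::field \<Rightarrow> 'k rf"
proof
  fix a b :: 'k and r :: "'k rf"
  obtain f where "r = cls f" by (metis cls_surj)
  then show "scal_rf a * r = r * scal_rf a"
    by (simp add: scal_rf_def fa.\<kappa>_commute flip: cls_simps)
qed (simp_all add: scal_rf_def fa.\<kappa>_add fa.\<kappa>_mult cls_simps)

definition var_rf :: "var \<Rightarrow> 'k::field rf" where "var_rf v = cls (var_fa v)"

lemma cls_hom: "cls (fa.hom \<psi> f) = rf.hom (\<lambda>v. cls (\<psi> v)) f"
proof -
  have s: "cls (sum F A) = (\<Sum>a\<in>A. cls (F a))" for F :: "var list \<Rightarrow> 'a fa" and A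
    by (induction A rule: infinite_finite_induct) (auto simp: cls_simps)
  have p: "cls (prod_list fs) = prod_list (map cls fs)" for fs :: "'a fa list"
    by (induction fs) (auto simp: cls_simps)
  show ?thesis
    by (simp add: fa.hom_def rf.hom_def fa.hom_ext_def rf.hom_ext_def s p cls_simps scal_rf_def comp_def)
qed

lemma cls_eq_hom: "cls f = rf.hom var_rf f"
  using cls_hom[of var_fa f] by (simp add: fa_as_sum[symmetric] var_rf_def[abs_def])

definition rf0 :: "'k::field rf set" where "rf0 = {cls f | f. coeff_fa f \<in> FA0}"
definition rf1 :: "'k::field rf set" where "rf1 = {cls f | f. coeff_fa f \<in> FA1}"

text \<open>Graded values in the quotient lift to a graded endomorphism of the free algebra, and the
  ideal is stable under it.\<close>

lemma rf_vanish:
  fixes \<eta> :: "var \<Rightarrow> 'k::field rf"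
  assumes "\<And>i. \<eta> (Y i) \<in> rf0" "\<And>i. \<eta> (Z i) \<in> rf1" "f \<in> gens"
  shows "rf.hom_ext \<eta> f = 0"
proof -
  have "\<exists>g. cls g = \<eta> v \<and> (if isZ v then coeff_fa g \<in> FA1 else coeff_fa g \<in> FA0)" for v
    using assms(1)[of "case v of Y i \<Rightarrow> i | Z i \<Rightarrow> i"] assms(2)[of "case v of Y i \<Rightarrow> i | Z i \<Rightarrow> i"]
    by (cases v) (auto simp: rf0_def rf1_def)
  then obtain \<psi> where \<psi>: "\<And>v. cls (\<psi> v) = \<eta> v"
    "\<And>v. if isZ v then coeff_fa (\<psi> v) \<in> FA1 else coeff_fa (\<psi> v) \<in> FA0" by metis
  have "f \<in> FA" using assms(3) gens_T2_A by (auto simp: T2_A_iff)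
  then have f: "coeff_fa (Abs_fa f) = f" by (simp add: Abs_fa_inverse)
  have "graded_endo (\<lambda>v. coeff_fa (\<psi> v))"
    unfolding graded_endo_def using \<psi>(2) by (metis isZ_simps)
  then have "psubst (\<lambda>v. coeff_fa (\<psi> v)) f \<in> T2_gen gens"
    using T2_gen_T2_ideal[OF gens_T2_A] subset_T2_gen assms(3) by (auto simp: is_T2_ideal_def)
  then have "fa.hom \<psi> (Abs_fa f) \<in> JJ"
    by (simp add: JJ_def psubst_eq_hom_ext coeff_fa coeff_fa_inverse fa.hom_def f)
  then have "cls (fa.hom \<psi> (Abs_fa f)) = 0" by (simp add: cls_eq_0)
  then show ?thesis by (simp add: cls_hom \<psi> rf.hom_def f)
qed

lemma var_rf_graded: "(var_rf (Y i) :: 'k::field rf) \<in> rf0" "(var_rf (Z i) :: 'k rf) \<in> rf1"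
proof -
  have "pvar v w \<noteq> (0 :: 'k) \<Longrightarrow> w = [v]" for v w by (simp add: pvar_def split: if_splits)
  then have "(pvar (Y i) :: 'k fpoly) \<in> FA0" "(pvar (Z i) :: 'k fpoly) \<in> FA1" for i
    unfolding FA0_def FA1_def using pvar_FA by (fastforce simp: wdeg_odd_def)+
  then show "(var_rf (Y i) :: 'k rf) \<in> rf0" "(var_rf (Z i) :: 'k rf) \<in> rf1"
    unfolding var_rf_def rf0_def rf1_def by (auto simp: var_fa.rep_eq)
qed

lemma wdeg_odd_append: "wdeg_odd (u @ v) = (wdeg_odd u \<noteq> wdeg_odd v)"
  by (simp add: wdeg_odd_def)

lemma rf01: assumes "a \<in> rf0" "b \<in> rf1" shows "a * b \<in> rf1"
proof -
  from assms obtain f g where fg: "a = cls f" "coeff_fa f \<in> FA0" "b = cls g" "coeff_fa g \<in> FA1"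
    by (auto simp: rf0_def rf1_def)
  have "wdeg_odd w" if "pmul (coeff_fa f) (coeff_fa g) w \<noteq> 0" for w
  proof -
    have "w \<in> (\<lambda>(u, v). u @ v) ` ({w. coeff_fa f w \<noteq> 0} \<times> {w. coeff_fa g w \<noteq> 0})"
      using that pmul_supp by blast
    then show ?thesis using fg by (auto simp: wdeg_odd_append FA0_def FA1_def)
  qed
  then have "coeff_fa (f * g) \<in> FA1"
    unfolding FA1_def using coeff_fa[of "f * g"] by (auto simp: times_fa.rep_eq)
  then show ?thesis using fg by (auto simp: rf1_def cls_simps[symmetric])
qed

interpretation rf: graded_identities "scal_rf :: 'k::field \<Rightarrow> 'k rf" rf0 rf1 var_rf
  by standard (auto intro: rf01 var_rf_graded rf_vanish simp: gens_def)

lemma rf_bracket_relations_p: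
  assumes "CHAR('k::field) > 2"
  shows "bracket_relations_p (var_rf :: var \<Rightarrow> 'k rf) CHAR('k)"
proof -
  interpret bracket_relations "var_rf :: var \<Rightarrow> 'k rf" by (rule rf.bracket_relations)
  have "prime CHAR('k)" using assms by (intro prime_CHAR_semidom) auto
  then have odd: "odd CHAR('k)" using assms prime_odd_nat by blast
  then obtain n where n: "CHAR('k) = 2 * n + 1" by (auto elim: oddE)
  have gens: "gens_p CHAR('k) \<subseteq> (gens :: 'k fpoly set)" using assms by (auto simp: gens_def)
  show ?thesis
  proof
    fix w i
    show "br var_rf w (Z i) * var_rf (Z i) ^ (CHAR('k) - 1) = (0 :: 'k rf)"
    proof (cases w)
      case (Y j)
      \<comment> \<open>The member \<open>k = 1\<close> of (9): the product has the single factor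
        \<open>[y 1, z 1]\<close>.\<close>
      let ?f = "pmul (pprod (map (\<lambda>i. pcomm (y i) (z 1)) [1..<2*1])) (ppow (z 1) (2*n)) :: 'k fpoly"
      let ?\<eta> = "(\<lambda>v. case v of Y _ \<Rightarrow> var_rf (Y j) | Z _ \<Rightarrow> var_rf (Z i)) :: var \<Rightarrow> 'k rf"
      have "?f \<in> gens_p CHAR('k)" unfolding gens_p_def using n by (intro UnI2) force
      then have "rf.hom_ext ?\<eta> ?f = 0"
        using gens by (intro rf_vanish) (auto simp: var_rf_graded)
      then show ?thesis
        using n Y by (simp add: rf.hom_ext_pmul rf.hom_ext_ppow rf.hom_ext_pcomm pprod_def upt_rec br_def)
    next
      case (Z j)
      \<comment> \<open>The member \<open>k = 1\<close> of (8): the product of commutators is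
        empty.\<close>
      let ?f = "pmul (pmul (pprod (map (\<lambda>i. pcomm (y i) (z 1)) [1..<2*1-1])) (pjor (z 2) (z 1))) (ppow (z 1) (2*n)) :: 'k fpoly"
      let ?\<eta> = "(\<lambda>v. case v of Y k \<Rightarrow> var_rf (Y k) | Z k \<Rightarrow> if k = 1 then var_rf (Z i) else var_rf (Z j)) :: var \<Rightarrow> 'k rf"
      have "?f \<in> gens_p CHAR('k)" unfolding gens_p_def using n by (intro UnI1) force
      then have "rf.hom_ext ?\<eta> ?f = 0"
        using gens by (intro rf_vanish) (auto simp: var_rf_graded)
      then show ?thesis
        using n Z by (simp add: rf.hom_ext_pmul rf.hom_ext_ppow rf.hom_ext_pjor pprod_def br_def)
    qed
  qed (rule odd)
qed

lemma normal_form: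
  fixes f :: "'k::field fa"
  assumes "CHAR('k) \<noteq> 2"
  obtains F c where "finite F" "F \<subseteq> normal CHAR('k)" "f - (\<Sum>m\<in>F. scal_fa (c m) * nf var_fa m) \<in> JJ"
proof -
  have CHAR: "CHAR('k) = 0 \<or> CHAR('k) > 2" using assms CHAR_not_1'[where 'a = 'k] by linarith
  have two: "(2 :: 'k) \<noteq> 0"
    using of_nat_eq_0_iff_char_dvd[of 2, where 'a = 'k] CHAR by (auto dest: dvd_imp_le)
  interpret bracket_relations "var_rf :: var \<Rightarrow> 'k rf" by (rule rf.bracket_relations)
  interpret spanning "scal_rf :: 'k \<Rightarrow> 'k rf" var_rf "CHAR('k)"
  proof
    fix ts i
    assume *: "0 < CHAR('k)" "CHAR('k) \<le> count (mset ts) (Z i)" "even (length ts)"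
    with CHAR interpret bracket_relations_p "var_rf :: var \<Rightarrow> 'k rf" "CHAR('k)"
      by (intro rf_bracket_relations_p) auto
    show "brs (var_rf :: var \<Rightarrow> 'k rf) ts = 0" using * brs_eq_0_power by blast
  qed (rule two)
  from hom_in_span[of f] obtain t r where t: "finite t" "t \<subseteq> nf var_rf ` normal CHAR('k)"
    and f: "cls f = (\<Sum>a\<in>t. scal_rf (r a) * a)"
    unfolding cls_eq_hom rf.span_explicit by auto
  \<comment> \<open>The span provides elements of the quotient rather than indices. Choosing one
    index for each element makes the sum over \<open>t\<close> a sum over \<open>F\<close>.\<close>
  from t obtain F where F: "F \<subseteq> normal CHAR('k)" "inj_on (nf (var_rf :: var \<Rightarrow> 'k rf)) F" "t = nf var_rf ` F"
    by (metis subset_image_inj)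
  have "finite F" using t(1) F finite_image_iff by blast
  have nf: "cls (nf var_fa m) = nf var_rf m" for m
    by (simp add: cls_eq_hom rf.hom_nf)
  define c where "c = (\<lambda>m. r (nf var_rf m))"
  have "cls (\<Sum>m\<in>F. scal_fa (c m) * nf var_fa m) = (\<Sum>m\<in>F. scal_rf (c m) * nf var_rf m)"
    using \<open>finite F\<close> by (induction F) (auto simp: cls_simps nf scal_rf_def)
  also have "\<dots> = cls f"
    unfolding f F(3) c_def by (subst sum.reindex[OF F(2)]) simp
  finally have "f - (\<Sum>m\<in>F. scal_fa (c m) * nf var_fa m) \<in> JJ"
    by (simp flip: cls_eq_iff)
  with \<open>finite F\<close> F(1) show thesis by (rule that)
qed

section \<open>Independence of the normal forms\<close>

lemma poly_eq_0_infinite: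
  fixes q :: "'k::field poly"
  assumes "infinite (UNIV :: 'k set)" "\<And>t. poly q t = 0"
  shows "q = 0"
proof (rule ccontr)
  assume "q \<noteq> 0"
  then have "finite {t. poly q t = 0}" by (rule poly_roots_finite)
  with assms show False by simp
qed

text \<open>Monomials are multisets of variables. With the other values fixed, the sum is a
  polynomial in the value of one variable \<open>a\<close>, and over an infinite field each of its
  coefficients is 0; these involve one variable fewer.\<close>

lemma multivariate_vanishing:
  fixes c :: "'x multiset \<Rightarrow> 'k::field"
  assumes inf: "infinite (UNIV :: 'k set)" and "finite V"
    and "\<And>\<rho>. (\<Sum>m\<in>V. c m * prod_mset (image_mset \<rho> m)) = 0" and "m \<in> V"
  shows "c m = 0"
proof -
  have "\<forall>m\<in>V. c m = 0"
    if "finite A" "finite V" "\<forall>m\<in>V. set_mset m \<subseteq> A"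
      "\<And>\<rho>. (\<Sum>m\<in>V. c m * prod_mset (image_mset \<rho> m)) = 0" for A V and c :: "'x multiset \<Rightarrow> 'k"
    using that
  proof (induction A arbitrary: V c rule: finite_induct)
    case empty
    then have "V \<subseteq> {{#}}" by auto
    then consider "V = {}" | "V = {{#}}" by blast
    then show ?case using empty(3)[of undefined] by cases auto
  next
    case (insert a A)
    define r where "r = filter_mset (\<lambda>x. x \<noteq> a)"
    have split: "m = replicate_mset (count m a) a + r m" for m
      using multiset_partition[of m "\<lambda>x. x = a"] by (simp add: r_def filter_eq_replicate_mset)
    show ?case
    proof
      fix m0 assume m0: "m0 \<in> V"
      define n where "n = count m0 a"
      define V' where "V' = {m \<in> V. count m a = n}"
      define c' where "c' = (\<lambda>w. c (replicate_mset n a + w))"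
      have inj: "inj_on r V'"
        by (rule inj_onI) (metis (mono_tags, lifting) V'_def mem_Collect_eq split)
      have c': "c' (r m) = c m" if "m \<in> V'" for m
        using that split[of m] by (simp add: c'_def V'_def)
      have "(\<Sum>w\<in>r ` V'. c' w * prod_mset (image_mset \<rho> w)) = 0" for \<rho>
      proof -
        \<comment> \<open>The sum as a polynomial in the value of \<open>a\<close>; its coefficient
          at \<open>n\<close> collects the monomials with exactly \<open>n\<close> copies of
          \<open>a\<close>.\<close>
        define q where "q = (\<Sum>m\<in>V. monom (c m * prod_mset (image_mset \<rho> (r m))) (count m a))"
        have "poly q t = 0" for t
        proof -
          have "prod_mset (image_mset (\<rho>(a := t)) m) = prod_mset (image_mset \<rho> (r m)) * t ^ count m a" for m
          proof -
            have "image_mset (\<rho>(a := t)) (r m) = image_mset \<rho> (r m)"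
              by (rule image_mset_cong) (simp add: r_def)
            then show ?thesis by (subst split[of m]) (simp add: mult.commute)
          qed
          then have "poly q t = (\<Sum>m\<in>V. c m * prod_mset (image_mset (\<rho>(a := t)) m))"
            by (simp add: q_def poly_sum poly_monom mult.assoc)
          then show ?thesis using insert.prems(3) by simp
        qed
        then have "q = 0" by (rule poly_eq_0_infinite[OF inf])
        moreover have "(\<Sum>m\<in>V. if count m a = n then c m * prod_mset (image_mset \<rho> (r m)) else 0) = coeff q n"
          by (simp add: q_def coeff_sum)
        ultimately have "(\<Sum>m\<in>V'. c m * prod_mset (image_mset \<rho> (r m))) = 0"
          unfolding V'_def using insert.prems(1) by (simp only: sum.inter_filter coeff_0)
        then show ?thesis by (simp add: sum.reindex[OF inj] c')
      qed
      moreover have "finite (r ` V')" using insert.prems(1) by (simp add: V'_def)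
      moreover have "\<forall>w\<in>r ` V'. set_mset w \<subseteq> A" using insert.prems(2) by (fastforce simp: V'_def r_def)
      ultimately have "\<forall>w\<in>r ` V'. c' w = 0" by (intro insert.IH)
      then show "c m0 = 0" using c'[of m0] m0 by (simp add: V'_def n_def)
    qed
  qed
  from this[of "\<Union> (set_mset ` V)" V c] assms show ?thesis by auto
qed

text \<open>Other indices may share monomials: collecting equal ones leaves \<open>k i0\<close>
  alone at \<open>mon i0\<close>.\<close>

lemma unique_monomial_vanishing:
  fixes k :: "'i \<Rightarrow> 'k::field" and mon :: "'i \<Rightarrow> 'x multiset"
  assumes "infinite (UNIV :: 'k set)" "finite I"
    and "\<And>\<rho>. (\<Sum>i\<in>I. k i * prod_mset (image_mset \<rho> (mon i))) = 0"
    and "i0 \<in> I" "\<And>i. i \<in> I \<Longrightarrow> mon i = mon i0 \<Longrightarrow> i = i0"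
  shows "k i0 = 0"
proof -
  define c where "c = (\<lambda>m. \<Sum>i\<in>{i \<in> I. mon i = m}. k i)"
  have "(\<Sum>m\<in>mon ` I. c m * prod_mset (image_mset \<rho> m)) = 0" for \<rho>
  proof -
    have "(\<Sum>i\<in>I. k i * prod_mset (image_mset \<rho> (mon i)))
      = (\<Sum>m\<in>mon ` I. \<Sum>i\<in>{i \<in> I. mon i = m}. k i * prod_mset (image_mset \<rho> (mon i)))"
      by (rule sum.image_gen) fact
    also have "\<dots> = (\<Sum>m\<in>mon ` I. c m * prod_mset (image_mset \<rho> m))"
      by (auto simp: c_def sum_distrib_right intro!: sum.cong)
    finally show ?thesis using assms(3) by simp
  qed
  then have "c (mon i0) = 0"
    using assms by - (rule multivariate_vanishing[of "mon ` I" c], auto)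
  moreover have "{i \<in> I. mon i = mon i0} = {i0}" using assms by blast
  ultimately show ?thesis by (simp add: c_def)
qed

lemma prod_list_add_expand:
  fixes a b :: "'v \<Rightarrow> 'r::ring_1"
  shows "prod_list (map (\<lambda>v. a v + b v) xs) =
    (\<Sum>bs\<in>{bs. length bs = length xs}. prod_list (map (\<lambda>(v, \<beta>). if \<beta> then a v else b v) (zip xs bs)))"
proof (induction xs)
  case (Cons v xs)
  let ?S = "{bs :: bool list. length bs = length xs}"
  let ?P = "\<lambda>xs bs. prod_list (map (\<lambda>(v, \<beta>). if \<beta> then a v else b v) (zip xs bs))"
  have fin: "finite ?S" using finite_lists_length_eq[of "UNIV :: bool set" "length xs"] by simp
  have "{bs. length bs = length (v # xs)} = (#) True ` ?S \<union> (#) False ` ?S"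
    by (auto simp: length_Suc_conv image_iff)
  then have "(\<Sum>bs\<in>{bs. length bs = length (v # xs)}. ?P (v # xs) bs)
    = (\<Sum>bs\<in>(#) True ` ?S. ?P (v # xs) bs) + (\<Sum>bs\<in>(#) False ` ?S. ?P (v # xs) bs)"
    using fin by (simp only:) (rule sum.union_disjoint, auto)
  also have "\<dots> = (\<Sum>bs\<in>?S. a v * ?P xs bs) + (\<Sum>bs\<in>?S. b v * ?P xs bs)"
    by (simp add: sum.reindex)
  finally show ?case using Cons by (simp add: distrib_right sum_distrib_left sum.distrib)
qed simp

lemma bihom_add:
  assumes "a \<in> bihom p q" "b \<in> bihom p q"
  shows "a + b \<in> bihom p q"
  unfolding bihom_def
proof clarify
  fix S T assume "coeff_ee (a + b) (S, T) \<noteq> 0"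
  then have "coeff_ee a (S, T) \<noteq> 0 \<or> coeff_ee b (S, T) \<noteq> 0" by (auto simp: plus_ee.rep_eq)
  then show "odd (card S) = p \<and> odd (card T) = q" using assms by (auto simp: bihom_def)
qed

lemma bihom_0 [simp]: "0 \<in> bihom p q"
  by (simp add: bihom_def zero_ee.rep_eq)

lemma bihom_sum: "(\<And>i. i \<in> A \<Longrightarrow> F i \<in> bihom p q) \<Longrightarrow> sum F A \<in> bihom p q"
  by (induction A rule: infinite_finite_induct) (auto intro: bihom_add)

lemma bihom_scal: "a \<in> bihom p q \<Longrightarrow> scal_ee c * a \<in> bihom p q"
  by (auto simp: bihom_def coeff_scal_ee_times)

lemma bihom_emon: "odd (card S) = p \<Longrightarrow> odd (card T) = q \<Longrightarrow> emon S T c \<in> bihom p q"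
  by (simp add: bihom_def coeff_emon)

section \<open>A generic substitution on which a selected normal form is nonzero\<close>

text \<open>Nonzero multiples of basis elements, with bounds on the generators used in each factor.
  Disjoint bounds guarantee that a product is again of this kind.\<close>

definition is_mono :: "nat set \<Rightarrow> nat set \<Rightarrow> 'k::field ee \<Rightarrow> bool" where
  "is_mono L R q \<longleftrightarrow> (\<exists>S T c. S \<subseteq> L \<and> T \<subseteq> R \<and> finite S \<and> finite T \<and> c \<noteq> 0 \<and> q = emon S T c)"

lemma is_mono_emon: "finite S \<Longrightarrow> finite T \<Longrightarrow> c \<noteq> 0 \<Longrightarrow> S \<subseteq> L \<Longrightarrow> T \<subseteq> R \<Longrightarrow> is_mono L R (emon S T c)"
  by (auto simp: is_mono_def)

lemma is_mono_weaken: "is_mono L R a \<Longrightarrow> L \<subseteq> L' \<Longrightarrow> R \<subseteq> R' \<Longrightarrow> is_mono L' R' a"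
  unfolding is_mono_def by (elim exE conjE) (intro exI conjI; (assumption | erule (1) subset_trans))

lemma is_mono_mult:
  assumes "is_mono L1 R1 a" "is_mono L2 R2 b" "L1 \<inter> L2 = {}" "R1 \<inter> R2 = {}" "L1 \<union> L2 \<subseteq> L" "R1 \<union> R2 \<subseteq> R"
  shows "is_mono L R (a * b)"
proof -
  from assms(1,2) obtain S T c S' T' c' where *: "S \<subseteq> L1" "T \<subseteq> R1" "finite S" "finite T" "c \<noteq> 0" "a = emon S T c"
    "S' \<subseteq> L2" "T' \<subseteq> R2" "finite S'" "finite T'" "c' \<noteq> 0" "b = emon S' T' c'"
    unfolding is_mono_def by blast
  then have "S \<inter> S' = {}" "T \<inter> T' = {}" using assms by blast+
  then have "a * b = emon (S \<union> S') (T \<union> T') (gsign S S' * gsign T T' * c * c')"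
    using * by (simp add: emon_times_emon)
  moreover have "gsign A B \<noteq> (0 :: 'a)" for A B by (simp add: gsign_def)
  ultimately show ?thesis using * assms by (auto intro!: is_mono_emon)
qed

lemma is_mono_1: "is_mono L R 1"
  using is_mono_emon[of "{}" "{}" "1 :: 'a" L R] by simp

lemma is_mono_scal:
  assumes "is_mono L R a" "c \<noteq> 0"
  shows "is_mono L R (scal_ee c * a)"
proof -
  from assms(1) obtain S T d where "S \<subseteq> L" "T \<subseteq> R" "finite S" "finite T" "d \<noteq> 0" "a = emon S T d"
    unfolding is_mono_def by blast
  with assms(2) show ?thesis by (auto simp: scal_ee_emon intro!: is_mono_emon)
qed

lemma is_mono_minus:
  assumes "is_mono L R a" shows "is_mono L R (- a)"
  using is_mono_scal[OF assms, of "- 1"] by (simp add: ee.\<kappa>_minus)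

lemma is_mono_nonzero:
  assumes "is_mono L R a" shows "a \<noteq> 0"
proof -
  from assms obtain S T c where "finite S" "finite T" "c \<noteq> 0" "a = emon S T c" by (auto simp: is_mono_def)
  then have "coeff_ee a (S, T) \<noteq> 0" by (simp add: coeff_emon)
  then show ?thesis by (auto simp: zero_ee.rep_eq)
qed

text \<open>The vanishing of the next power is part of the induction: it removes the term of the
  binomial expansion without \<open>d n\<close>.\<close>

lemma sum_power_square_zero:
  fixes d :: "nat \<Rightarrow> 'r::ring_1"
  assumes comm: "\<And>i j. d i * d j = d j * d i" and sq: "\<And>i. d i * d i = 0"
  shows "sum d {..<n} ^ n = of_nat (fact n) * prod_list (map d [0..<n]) \<and> sum d {..<n} ^ Suc n = 0"
proof (induction n)
  case (Suc n)
  have "sum d {..<n} * d n = d n * sum d {..<n}"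
    by (simp add: sum_distrib_left sum_distrib_right comm[of n])
  then have "(sum d {..<n} + d n) ^ Suc k = sum d {..<n} ^ Suc k + of_nat (Suc k) * (sum d {..<n} ^ k * d n)" for k
    by (rule square_zero_power) (rule sq)
  note power = this
  have "sum d {..<n} ^ Suc (Suc n) = 0"
    using Suc by (metis mult_zero_right power_Suc)
  then show ?case
    using Suc power[of n] power[of "Suc n"]
    by (simp add: mult.assoc del: of_nat_Suc power_Suc mult_Suc)
qed simp

text \<open>Each variable owns countably many generators. In the right factor index 0 belongs to
  \<open>gh\<close> and the positive indices to \<open>th\<close>, which keeps words and strings
  apart.\<close>

definition enc :: "var \<Rightarrow> nat \<Rightarrow> nat" where
  "enc v j = (case v of Y i \<Rightarrow> prod_encode (2 * i, j) | Z i \<Rightarrow> prod_encode (2 * i + 1, j))"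

lemma enc_eq_iff [simp]: "enc v i = enc w j \<longleftrightarrow> v = w \<and> i = j"
  by (cases v; cases w) (auto simp: enc_def, presburger+)

text \<open>A generic substitution: \<open>gh v + th v\<close>, rescaled by independent scalars, separates the normal
  forms. The number \<open>m v\<close> of summands in \<open>th m v\<close> is the largest power of it that survives.\<close>
definition gh :: "var \<Rightarrow> 'k::field ee" where
  "gh v = (if isZ v then emon {} {enc v 0} 1 else 1)"

definition th :: "(var \<Rightarrow> nat) \<Rightarrow> var \<Rightarrow> 'k::field ee" where
  "th m v = (if isZ v then \<Sum>j<m v. emon {enc v (Suc j)} {enc v (Suc j)} 1 else emon {enc v 0} {} 1)"

lemma gh_bihom: "gh v \<in> bihom False (isZ v)"
  by (auto simp: gh_def bihom_emon simp flip: ee.\<kappa>_1)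

lemma th_bihom: "th m v \<in> bihom True (isZ v)"
  by (auto simp: th_def bihom_emon intro: bihom_sum)

text \<open>For odd variables \<open>gh\<close> squares to 0, hence the bound on multiplicities; for
  even ones it is 1.\<close>

lemma is_mono_gh:
  "(\<And>i. count (mset xs) (Z i) \<le> 1) \<Longrightarrow> is_mono {} ((\<lambda>v. enc v 0) ` set xs) (prod_list (map gh xs))"
proof (induction xs)
  case (Cons v xs)
  have "count (mset xs) (Z i) \<le> 1" for i
    by (rule order_trans[OF _ Cons.prems[of i]]) simp
  note IH = Cons.IH[OF this]
  show ?case
  proof (cases v)
    case (Y i)
    with IH show ?thesis by (auto simp: gh_def is_mono_def)
  next
    case (Z i)
    then have "v \<notin> set xs" using Cons.prems[of i] by (auto simp: count_eq_zero_iff)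
    moreover have "is_mono {} {enc v 0} (gh v)" using Z by (auto simp: gh_def intro: is_mono_emon)
    ultimately show ?thesis using IH by (auto intro!: is_mono_mult)
  qed
qed (simp add: is_mono_1)

lemma is_mono_th_power:
  assumes "isZ v \<Longrightarrow> of_nat (fact (m v)) \<noteq> (0 :: 'k::field)" "\<not> isZ v \<Longrightarrow> m v \<le> 1"
  shows "is_mono (range (enc v)) (enc v ` {0<..}) (th m v ^ m v :: 'k ee)"
proof (cases "isZ v")
  case True
  define d :: "nat \<Rightarrow> 'k ee" where "d = (\<lambda>j. emon {enc v (Suc j)} {enc v (Suc j)} 1)"
  have "d i * d j = d j * d i" for i j
    using bihom_commute[of "d i" True True "d j" True True] by (auto simp: d_def bihom_emon)
  moreover have "d i * d i = 0" for i by (simp add: d_def emon_square)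
  ultimately have "sum d {..<m v} ^ m v = of_nat (fact (m v)) * prod_list (map d [0..<m v])"
    using sum_power_square_zero by blast
  then have th: "th m v ^ m v = scal_ee (of_nat (fact (m v))) * prod_list (map d [0..<m v])"
    using True by (simp add: th_def d_def ee.\<kappa>_of_nat)
  have "is_mono ((\<lambda>j. enc v (Suc j)) ` {..<n}) ((\<lambda>j. enc v (Suc j)) ` {..<n}) (prod_list (map d [0..<n]))" for n
  proof (induction n)
    case (Suc n)
    have "is_mono {enc v (Suc n)} {enc v (Suc n)} (d n)" by (auto simp: d_def intro: is_mono_emon)
    with Suc show ?case by (auto intro!: is_mono_mult)
  qed (simp add: is_mono_1)
  note this[of "m v"]
  then have "is_mono (range (enc v)) (enc v ` {0<..}) (prod_list (map d [0..<m v]))"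
    by (rule is_mono_weaken) auto
  then show ?thesis unfolding th using assms True by (intro is_mono_scal) auto
next
  case False
  then have "m v = 0 \<or> m v = 1" using assms by linarith
  then show ?thesis using False by (auto simp: th_def is_mono_1 intro!: is_mono_emon)
qed

text \<open>Grouping equal letters costs only a sign, and the powers of different letters use
  disjoint generators.\<close>

lemma is_mono_th:
  fixes ts :: "var list" and m
  defines "m \<equiv> count (mset ts)"
  assumes "\<And>v. isZ v \<Longrightarrow> of_nat (fact (m v)) \<noteq> (0 :: 'k::field)" "\<And>v. \<not> isZ v \<Longrightarrow> m v \<le> 1"
  shows "is_mono UNIV (\<Union>v. enc v ` {0<..}) (prod_list (map (th m) ts) :: 'k ee)"
proof -
  have colour: "colour gh (th m :: var \<Rightarrow> 'k ee)" by standard (rule gh_bihom th_bihom)+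
  obtain vs where vs: "distinct vs" "set vs = set ts" by (metis distinct_remdups set_remdups)
  define us where "us = concat (map (\<lambda>v. replicate (m v) v) vs)"
  have "count (mset us) v = (if v \<in> set vs then m v else 0)" for v
    unfolding us_def using vs(1) by (induction vs) auto
  then have "mset ts = mset us"
    using vs(2) by (intro multiset_eqI) (auto simp: m_def count_eq_zero_iff)
  then have sign: "prod_list (map (th m) ts) \<in> {prod_list (map (th m) us), - prod_list (map (th m) us) :: 'k ee}"
  proof (rule mset_eq_induct_swap[rotated 3], goal_cases)
    case (3 as v w bs)
    show ?case using colour.tt[OF colour, of v w] by (auto simp: mult.assoc[symmetric])
  qed auto
  have pow: "prod_list (map (th m) (replicate k v)) = (th m v ^ k :: 'k ee)" for k v by simp
  have "is_mono (\<Union>v\<in>set vs. range (enc v)) (\<Union>v\<in>set vs. enc v ` {0<..}) (prod_list (map (th m) us) :: 'k ee)"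
    unfolding us_def using vs(1)
  proof (induction vs)
    case (Cons v vs)
    have "is_mono (range (enc v)) (enc v ` {0<..}) (th m v ^ m v :: 'k ee)"
      using assms by (intro is_mono_th_power) auto
    with Cons show ?case by (auto simp: pow intro!: is_mono_mult)
  qed (simp add: is_mono_1)
  then have "is_mono UNIV (\<Union>v. enc v ` {0<..}) (prod_list (map (th m) us) :: 'k ee)"
    by (rule is_mono_weaken) auto
  then show ?thesis using sign is_mono_minus by auto
qed

lemma brs_colour:
  assumes "colour g t" "even (length ts)"
  shows "brs (\<lambda>v. g v + t v) ts = 2 ^ (length ts div 2) * prod_list (map t ts)"
  using assms(2)
proof (induction ts rule: induct_list012)
  case (3 v w ts)
  let ?n = "length ts div 2"
  have "t v * t w * (2 ^ ?n * q) = 2 ^ ?n * (t v * t w * q)" for q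
    using mult_of_nat_commute[of "2 ^ ?n" "t v * t w"] by (simp flip: mult.assoc)
  with 3 show ?case by (simp add: colour.br_eq[OF assms(1)] mult.assoc)
qed auto

lemma prod_list_scal_ee:
  "prod_list (map (\<lambda>v. scal_ee (r v) * q v) xs) = scal_ee (prod_list (map r xs)) * prod_list (map q xs)"
proof (induction xs)
  case (Cons v xs)
  have "scal_ee (r v) * q v * (scal_ee c * b) = scal_ee (r v * c) * (q v * b)" for c b
    by (simp only: ee.\<kappa>_mult mult.assoc ee.\<kappa>_left_commute[of "q v"])
  with Cons show ?case by simp
qed simp

lemma of_nat_fact_nonzero:
  assumes "CHAR('k::field) > 0 \<Longrightarrow> n < CHAR('k)"
  shows "of_nat (fact n) \<noteq> (0 :: 'k)"
proof
  assume "of_nat (fact n) = (0 :: 'k)"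
  then have dvd: "CHAR('k) dvd fact n" by (simp only: of_nat_eq_0_iff_char_dvd)
  then have pos: "CHAR('k) > 0" by (metis dvd_0_left fact_nonzero gr0I)
  then have "prime CHAR('k)" by (intro prime_CHAR_semidom) auto
  with dvd have "CHAR('k) \<le> n" by (simp add: prime_dvd_fact_iff)
  with assms pos show False by simp
qed

text \<open>A longest word among the terms that occur yields a scalar monomial that no other term
  produces. Its coefficient would have to vanish, yet the substitution is built so that it does
  not.\<close>

lemma normal_forms_independent:
  fixes c :: "var multiset \<times> var multiset \<Rightarrow> 'k::field"
  assumes inf: "infinite (UNIV :: 'k set)" and two: "(2 :: 'k) \<noteq> 0"
    and F: "finite F" "F \<subseteq> normal CHAR('k)"
    and vanish: "\<And>\<eta> :: var \<Rightarrow> 'k ee. ee_graded \<eta> \<Longrightarrow> (\<Sum>m\<in>F. scal_ee (c m) * nf \<eta> m) = 0"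
    and "m \<in> F"
  shows "c m = 0"
proof (rule ccontr)
  assume "c m \<noteq> 0"
  \<comment> \<open>Restricting to nonzero coefficients ensures that the longest word chosen below
    really occurs.\<close>
  define F' where "F' = {m \<in> F. c m \<noteq> 0}"
  have "m \<in> F'" using \<open>m \<in> F\<close> \<open>c m \<noteq> 0\<close> by (simp add: F'_def)
  then have F': "finite F'" "F' \<noteq> {}" using F(1) by (simp add: F'_def, blast)
  obtain X0 T0 where m0: "(X0, T0) \<in> F'" and max: "\<And>X T. (X, T) \<in> F' \<Longrightarrow> size X \<le> size X0"
  proof -
    have "Max ((\<lambda>m. size (fst m)) ` F') \<in> (\<lambda>m. size (fst m)) ` F'" using F' by (intro Max_in) auto
    then obtain m0 where "m0 \<in> F'" "Max ((\<lambda>m. size (fst m)) ` F') = size (fst m0)" by blast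
    moreover have "size (fst m) \<le> Max ((\<lambda>m. size (fst m)) ` F')" if "m \<in> F'" for m
      using F'(1) that by (intro Max_ge) auto
    ultimately have "m0 \<in> F'" "\<forall>m\<in>F'. size (fst m) \<le> size (fst m0)" by auto
    then show thesis by (intro that[of "fst m0" "snd m0"]) auto
  qed
  have normal: "(X, T) \<in> normal CHAR('k)" if "(X, T) \<in> F'" for X T using F that by (auto simp: F'_def)
  \<comment> \<open>The substitution is adapted to \<open>T0\<close>: \<open>th\<close> gets as many
    summands for an odd variable as it has copies in this string.\<close>
  let ?th = "th (count T0) :: var \<Rightarrow> 'k ee"
  \<comment> \<open>An index is a normal form with a choice of \<open>gh\<close> (True) or
    \<open>th\<close> (False) for each letter of its word. \<open>mon\<close> is the monomial in the
    scaling parameters: \<open>(v, True)\<close> scales \<open>gh v\<close> and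
    \<open>(v, False)\<close> scales \<open>th v\<close>.\<close>
  define I where "I = Sigma F' (\<lambda>m. {bs :: bool list. length bs = size (fst m)})"
  define mon where "mon = (\<lambda>((X :: var multiset, T), bs). mset (zip (lst X) bs) + image_mset (\<lambda>v. (v, False)) T)"
  define H where "H = (\<lambda>((X, T), bs). prod_list (map (\<lambda>(v, \<beta>). if \<beta> then gh v else ?th v) (zip (lst X) bs))
      * prod_list (map ?th (lst T)))"
  define e where "e = (\<lambda>((X, T), bs :: bool list). c (X, T) * 2 ^ (size T div 2))"
  have finI: "finite I" unfolding I_def
    using F'(1) finite_lists_length_eq[of "UNIV :: bool set"] by (intro finite_SigmaI) simp_all
  have sum0: "(\<Sum>i\<in>I. scal_ee (e i * prod_mset (image_mset \<rho> (mon i))) * H i) = 0" for \<rho> :: "var \<times> bool \<Rightarrow> 'k"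
  proof -
    let ?g = "\<lambda>v. scal_ee (\<rho> (v, True)) * gh v" and ?t = "\<lambda>v. scal_ee (\<rho> (v, False)) * ?th v"
    have colour: "colour ?g ?t"
      by standard (rule bihom_scal gh_bihom th_bihom)+
    let ?\<eta> = "\<lambda>v. ?g v + ?t v"
    have "?\<eta> v \<in> {a. \<forall>S T. coeff_ee a (S, T) \<noteq> 0 \<longrightarrow> odd (card T) = isZ v}" for v
    proof clarify
      fix S T assume "coeff_ee (?\<eta> v) (S, T) \<noteq> 0"
      then have "coeff_ee (?g v) (S, T) \<noteq> 0 \<or> coeff_ee (?t v) (S, T) \<noteq> 0"
        by (auto simp: plus_ee.rep_eq)
      then show "odd (card T) = isZ v"
        using colour.g[OF colour, of v] colour.t[OF colour, of v] unfolding bihom_def by blast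
    qed
    then have "ee_graded ?\<eta>" by (simp add: ee_graded_def)
    have expand: "scal_ee (c m) * nf ?\<eta> m
      = (\<Sum>bs\<in>{bs. length bs = size (fst m)}. scal_ee (e (m, bs) * prod_mset (image_mset \<rho> (mon (m, bs)))) * H (m, bs))"
      if "m \<in> F'" for m
    proof -
      obtain X T where m: "m = (X, T)" by fastforce
      have evenT: "even (length (lst T))" using normal[of X T] that m by (simp add: normal_def)
      let ?B = "{bs :: bool list. length bs = size X}"
      let ?h = "\<lambda>bs. prod_list (map (\<lambda>(v, \<beta>). if \<beta> then gh v else ?th v) (zip (lst X) bs))"
      let ?p = "\<lambda>bs. prod_list (map \<rho> (zip (lst X) bs))"
      have "(\<lambda>(v, \<beta>). if \<beta> then ?g v else ?t v) = (\<lambda>vb. scal_ee (\<rho> vb) * (case vb of (v, \<beta>) \<Rightarrow> if \<beta> then gh v else ?th v))"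
        by (auto simp: fun_eq_iff)
      then have X: "prod_list (map ?\<eta> (lst X)) = (\<Sum>bs\<in>?B. scal_ee (?p bs) * ?h bs)"
        unfolding prod_list_add_expand by (simp add: prod_list_scal_ee)
      let ?q = "prod_list (map (\<lambda>v. \<rho> (v, False)) (lst T))"
      have "(2 :: 'k ee) ^ n = scal_ee (2 ^ n)" for n
        using ee.\<kappa>_of_nat[of "2 ^ n", where 'k = 'k] by simp
      then have T: "brs ?\<eta> (lst T) = scal_ee (2 ^ (size T div 2) * ?q) * prod_list (map ?th (lst T))"
        by (simp only: brs_colour[OF colour evenT] length_lst prod_list_scal_ee ee.\<kappa>_mult mult.assoc)
      have "scal_ee (c m) * nf ?\<eta> m = (\<Sum>bs\<in>?B. scal_ee (c m) *
          ((scal_ee (?p bs) * ?h bs) * (scal_ee (2 ^ (size T div 2) * ?q) * prod_list (map ?th (lst T)))))"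
        unfolding m nf_def by (simp add: X T sum_distrib_left sum_distrib_right)
      also have "\<dots> = (\<Sum>bs\<in>?B. scal_ee (c m * (?p bs * (2 ^ (size T div 2) * ?q))) * (?h bs * prod_list (map ?th (lst T))))"
        by (simp only: ee.\<kappa>_mult[of "c m"] ee.\<kappa>_mult[of "?p _"] mult.assoc ee.\<kappa>_left_commute[of "?h _"])
      also have "\<dots> = (\<Sum>bs\<in>?B. scal_ee (e (m, bs) * prod_mset (image_mset \<rho> (mon (m, bs)))) * H (m, bs))"
      proof (rule sum.cong[OF refl])
        fix bs
        have "?q = prod_mset (image_mset \<rho> (image_mset (\<lambda>v. (v, False)) T))"
          by (simp only: prod_mset_prod_list[symmetric] mset_map mset_lst image_mset.compositionality comp_def)
        moreover have "?p bs = prod_mset (image_mset \<rho> (mset (zip (lst X) bs)))"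
          by (simp only: prod_mset_prod_list[symmetric] mset_map)
        ultimately have "c m * (?p bs * (2 ^ (size T div 2) * ?q)) = e (m, bs) * prod_mset (image_mset \<rho> (mon (m, bs)))"
          by (simp add: m e_def mon_def mult_ac)
        then show "scal_ee (c m * (?p bs * (2 ^ (size T div 2) * ?q))) * (?h bs * prod_list (map ?th (lst T)))
          = scal_ee (e (m, bs) * prod_mset (image_mset \<rho> (mon (m, bs)))) * H (m, bs)"
          by (simp add: m H_def)
      qed
      finally show ?thesis by (simp add: m)
    qed
    have "(\<Sum>i\<in>I. scal_ee (e i * prod_mset (image_mset \<rho> (mon i))) * H i)
      = (\<Sum>m\<in>F'. \<Sum>bs\<in>{bs. length bs = size (fst m)}. scal_ee (e (m, bs) * prod_mset (image_mset \<rho> (mon (m, bs)))) * H (m, bs))"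
      unfolding I_def using F'(1) finite_lists_length_eq[of "UNIV :: bool set"]
      by (subst sum.Sigma) (auto simp: split_def)
    also have "\<dots> = (\<Sum>m\<in>F'. scal_ee (c m) * nf ?\<eta> m)"
      by (rule sum.cong) (simp_all only: expand)
    also have "\<dots> = (\<Sum>m\<in>F. scal_ee (c m) * nf ?\<eta> m)"
      using F(1) by (intro sum.mono_neutral_left) (auto simp: F'_def)
    finally show ?thesis using vanish[OF \<open>ee_graded ?\<eta>\<close>] by simp
  qed
  define i0 where "i0 = ((X0, T0), replicate (size X0) True)"
  have "i0 \<in> I" using m0 by (auto simp: I_def i0_def)
  \<comment> \<open>The number of True parameters in \<open>mon i\<close> is at most
    \<open>size X\<close>, which is at most \<open>size X0\<close>. Equality forces
    \<open>gh\<close> at every letter; then the True parameters spell out \<open>X\<close> and the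
    False ones \<open>T\<close>.\<close>
  have unique: "i = i0" if i: "i \<in> I" "mon i = mon i0" for i
  proof -
    obtain X T bs where i': "i = ((X, T), bs)" by (metis surj_pair)
    then have X: "(X, T) \<in> F'" "length bs = size X" using i by (auto simp: I_def)
    have zip_True: "mset (zip (lst X) (replicate (size X) True)) = image_mset (\<lambda>v. (v, True)) X" for X :: "var multiset"
    proof -
      have "zip (lst X) (replicate (size X) True) = map (\<lambda>v. (v, True)) (lst X)"
        by (simp add: zip_replicate2)
      then show ?thesis by simp
    qed
    have filter0: "filter_mset snd (image_mset (\<lambda>v. (v, False)) T) = {#}" for T :: "var multiset"
      by (induction T) auto
    have filter1: "filter_mset snd (image_mset (\<lambda>v. (v, True)) T) = image_mset (\<lambda>v. (v, True)) T" for T :: "var multiset"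
      by (induction T) auto
    have "length (filter snd (zip (lst X) bs)) = size (filter_mset snd (mon i))"
      unfolding i' mon_def by (simp add: filter0 flip: mset_filter)
    also have "\<dots> = size X0"
      unfolding i(2) by (simp add: i0_def mon_def zip_True filter0 filter1)
    finally have "length (filter snd (zip (lst X) bs)) = size X0" .
    then have "length (filter (\<lambda>\<beta>. \<beta>) (map snd (zip (lst X) bs))) = size X0"
      by (simp add: filter_map comp_def)
    then have len: "length (filter (\<lambda>\<beta>. \<beta>) bs) = size X0" using X(2) by simp
    with max[OF X(1)] X(2) have size: "size X = size X0" "length (filter (\<lambda>\<beta>. \<beta>) bs) = length bs"
      using length_filter_le[of "\<lambda>\<beta>. \<beta>" bs] by auto
    then have "\<forall>\<beta>\<in>set bs. \<beta>" by (metis length_filter_less less_irrefl)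
    then have bs: "bs = replicate (size X) True"
      using X(2) by (metis (full_types) replicate_eqI)
    have "filter_mset snd (mon i) = filter_mset snd (mon i0)" using i(2) by simp
    then have "image_mset (\<lambda>v. (v, True)) X = image_mset (\<lambda>v. (v, True)) X0"
      by (simp add: i' i0_def mon_def bs zip_True filter0 filter1)
    then have "image_mset fst (image_mset (\<lambda>v. (v, True)) X) = image_mset fst (image_mset (\<lambda>v. (v, True)) X0)" by simp
    then have "X = X0" by (simp add: image_mset.compositionality comp_def)
    moreover from this have "image_mset (\<lambda>v. (v, False)) T = image_mset (\<lambda>v. (v, False)) T0"
      using i(2) by (simp add: i' i0_def mon_def bs)
    then have "image_mset fst (image_mset (\<lambda>v. (v, False)) T) = image_mset fst (image_mset (\<lambda>v. (v, False)) T0)" by simp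
    then have "T = T0" by (simp add: image_mset.compositionality comp_def)
    ultimately show ?thesis using i' bs i0_def by simp
  qed
  \<comment> \<open>The vanishing lemma concerns coefficients in the field, so it is applied to each
    coordinate of \<open>E \<otimes> E\<close> separately.\<close>
  have "e i0 * coeff_ee (H i0) st = 0" for st
  proof (rule unique_monomial_vanishing[OF inf finI, of "\<lambda>i. e i * coeff_ee (H i) st" mon])
    fix \<rho> :: "var \<times> bool \<Rightarrow> 'k"
    have "coeff_ee (\<Sum>i\<in>I. scal_ee (e i * prod_mset (image_mset \<rho> (mon i))) * H i) st = 0"
      unfolding sum0 by (simp add: zero_ee.rep_eq)
    then show "(\<Sum>i\<in>I. e i * coeff_ee (H i) st * prod_mset (image_mset \<rho> (mon i))) = 0"
      by (simp add: coeff_sum_ee coeff_scal_ee_times mult_ac)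
  qed (use \<open>i0 \<in> I\<close> unique in auto)
  moreover have "e i0 \<noteq> 0" using m0 two by (simp add: e_def i0_def F'_def)
  ultimately have "H i0 = 0" by (intro ee_eqI) (simp add: zero_ee.rep_eq)
  have "map (\<lambda>(v, \<beta>). if \<beta> then gh v else ?th v) (zip (lst X0) (replicate (size X0) True)) = map gh (lst X0)"
    by (rule nth_equalityI) auto
  then have H: "H i0 = prod_list (map gh (lst X0)) * prod_list (map ?th (lst T0))"
    by (simp add: H_def i0_def)
  have n0: "(X0, T0) \<in> normal CHAR('k)" using normal m0 by blast
  have "is_mono {} ((\<lambda>v. enc v 0) ` set (lst X0)) (prod_list (map gh (lst X0)) :: 'k ee)"
    using n0 by (intro is_mono_gh) (auto simp: normal_def)
  moreover have "is_mono UNIV (\<Union>v. enc v ` {0<..}) (prod_list (map (th (count (mset (lst T0)))) (lst T0)) :: 'k ee)"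
  proof (rule is_mono_th)
    fix v assume "isZ v"
    then obtain i where "v = Z i" by (cases v) auto
    then show "of_nat (fact (count (mset (lst T0)) v)) \<noteq> (0 :: 'k)"
      using n0 by (intro of_nat_fact_nonzero) (auto simp: normal_def)
  next
    fix v assume "\<not> isZ v"
    then obtain i where "v = Y i" by (cases v) auto
    then show "count (mset (lst T0)) v \<le> 1" using n0 by (auto simp: normal_def)
  qed
  \<comment> \<open>On the left the word uses no generators; on the right it uses index 0 and the
    string only positive indices. So the two basis elements have a nonzero product.\<close>
  ultimately have "is_mono UNIV UNIV (H i0)"
    unfolding H by (intro is_mono_mult[of "{}" _ _ UNIV]) auto
  with \<open>H i0 = 0\<close> show False using is_mono_nonzero by blast
qed

text \<open>Modulo the ideal, an identity \<open>f\<close> is a combination of normal forms. The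
  ideal consists of identities, so this combination is an identity too, and independence makes all
  its coefficients 0.\<close>

lemma T2_A_eq_T2_gen:
  assumes "infinite (UNIV :: 'k::field set)" "CHAR('k) \<noteq> 2"
  shows "(T2_A :: 'k fpoly set) = T2_gen gens"
proof
  show "T2_gen gens \<subseteq> (T2_A :: 'k fpoly set)" by (rule T2_gen_subset_T2_A[OF gens_T2_A])
  show "(T2_A :: 'k fpoly set) \<subseteq> T2_gen gens"
  proof
    fix f :: "'k fpoly" assume f: "f \<in> T2_A"
    then have f': "coeff_fa (Abs_fa f) = f" by (simp add: T2_A_iff Abs_fa_inverse)
    obtain F c where F: "finite F" "F \<subseteq> normal CHAR('k)"
      and J: "Abs_fa f - (\<Sum>m\<in>F. scal_fa (c m) * nf var_fa m) \<in> JJ"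
      using normal_form[OF assms(2)] by blast
    let ?s = "\<Sum>m\<in>F. scal_fa (c m) * nf var_fa m"
    have "2 \<le> CHAR('k) \<or> CHAR('k) = 0" using CHAR_not_1'[where 'a = 'k] by linarith
    then have two: "(2 :: 'k) \<noteq> 0"
      using of_nat_eq_0_iff_char_dvd[of 2, where 'a = 'k] assms(2) by (auto dest: dvd_imp_le)
    have "(\<Sum>m\<in>F. scal_ee (c m) * nf \<eta> m) = 0" if "ee_graded \<eta>" for \<eta> :: "var \<Rightarrow> 'k ee"
    proof -
      have "ee.hom \<eta> (Abs_fa f - ?s) = 0"
        using J that T2_gen_subset_T2_A[OF gens_T2_A] unfolding JJ_def ee.hom_def by (auto simp: T2_A_iff)
      moreover have "ee.hom \<eta> (Abs_fa f) = 0" using f that by (simp add: ee.hom_def f' T2_A_iff)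
      ultimately show ?thesis by (simp add: ee.hom_sum ee.hom_nf)
    qed
    then have "c m = 0" if "m \<in> F" for m
      using normal_forms_independent[OF assms(1) two F] that by blast
    then have "?s = 0" by simp
    with J have "Abs_fa f \<in> JJ" by simp
    then show "f \<in> T2_gen gens" by (simp add: JJ_def f')
  qed
qed

theorem mainTheorem10:
  shows "(CHAR('k::field) = 0 \<longrightarrow> (T2_A :: 'k fpoly set) = I_ideal)
       \<and> (infinite (UNIV :: 'k set) \<and> CHAR('k) > 2 \<longrightarrow> (T2_A :: 'k fpoly set) = I_p_ideal CHAR('k))"
proof (intro conjI impI)
  assume char: "CHAR('k) = 0"
  then have "infinite (UNIV :: 'k set)" using finite_imp_CHAR_pos by (metis less_irrefl)
  from T2_A_eq_T2_gen[OF this] char show "(T2_A :: 'k fpoly set) = I_ideal"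
    by (simp add: I_ideal_def gens_def)
next
  assume "infinite (UNIV :: 'k set) \<and> CHAR('k) > 2"
  then show "(T2_A :: 'k fpoly set) = I_p_ideal CHAR('k)"
    using T2_A_eq_T2_gen[where 'k = 'k] by (simp add: I_p_ideal_def gens_def)
qed

end
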